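(* For each $n$ let $G$ be a random $(d_L,d_R)$-biregular bipartite graph on $m+n$ vertices, and suppose that (i) $\lim_{n\to\infty} d_R=\infty$; (ii) for any fixed $\epsilon>0$, $d_R=o(n^{\epsilon})$; (iii) $d_R/d_L\to y$ as $n\to\infty$, where $1\le y<\infty$. Let $A=\begin{pmatrix} 0 & X \\ {X^T} & 0 \end{pmatrix}$ be the adjacency matrix of $G$ (with the vertices of the left class listed first, so that $X$ is an $m\times n$ matrix). Then as $n\to\infty$ the empirical spectral distribution of $\frac{1}{d_R}X^TX$ converges almost surely to the Marčenko–Pastur law with ratio $y^{-1}$, i.e. to the probability distribution supported on $[a^2,b^2]$ and given on that interval by the density $$p(x)=\frac{y}{2\pi x}\sqrt{(b^2-x)(x-a^2)},$$ where $a=1-y^{-1/2}$ and $b=1+y^{-1/2}$.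
   Context: Graphs have no loops or parallel edges. A bipartite graph with vertex classes $L$ (left) and $R$ (right) is $(d_L,d_R)$-biregular if every vertex in $L$ has degree $d_L$ and every vertex in $R$ has degree $d_R$. It is always assumed that $d_R\ge d_L$ (hence $|L|\ge|R|$). A random $(d_L,d_R)$-biregular bipartite graph on $m+n$ vertices is a graph chosen uniformly from all $(d_L,d_R)$-biregular bipartite graphs with $|L|=m$, $|R|=n$ (so $md_L=nd_R$). One considers a sequence of such random graphs indexed by $n\to\infty$, where $m,d_L,d_R$ depend on $n$; all graphs are defined on one probability space, with arbitrary joint distribution. The empirical spectral distribution (ESD) of a symmetric $N\times N$ matrix with eigenvalues $\lambda_1,\dots,\lambda_N$ is the probability measure $\frac1N\sum_{i=1}^N\delta_{\lambda_i}$. A sequence of random probability measures $\mu_n$ on $\mathbb{R}$ converges almost surely to a deterministic probability measure $\mu$ if $\int f\,d\mu_n\to\int f\,d\mu$ almost surely for all bounded continuous $f:\mathbb{R}\to\mathbb{R}$. *)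

theory Defs
  imports
    "HOL-Probability.Probability"
    "HOL-Library.Landau_Symbols"
    "Jordan_Normal_Form.Char_Poly"
begin

(* The left class is {..<m} and the right class is {m..<m + n}, so left vertices are listed
   first.  A graph is its set of edges; an edge is the two-element set of its endpoints. *)

definition vertex_degree :: "nat set set \<Rightarrow> nat \<Rightarrow> nat" where
  "vertex_degree E v = card {e \<in> E. v \<in> e}"

definition biregular_graphs :: "nat \<Rightarrow> nat \<Rightarrow> nat \<Rightarrow> nat \<Rightarrow> nat set set set" where
  "biregular_graphs m n dL dR =
     {E. E \<subseteq> {{u, v} | u v. u \<in> {..<m} \<and> v \<in> {m..<m + n}} \<and>
         (\<forall>u \<in> {..<m}. vertex_degree E u = dL) \<and>
         (\<forall>v \<in> {m..<m + n}. vertex_degree E v = dR)}"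

(* Since measurable functions map the space of M into the target space, G takes values in
   biregular_graphs everywhere on M.  In particular such graphs exist, so m * dL = n * dR. *)
definition random_biregular_graph ::
  "'w measure \<Rightarrow> nat \<Rightarrow> nat \<Rightarrow> nat \<Rightarrow> nat \<Rightarrow> ('w \<Rightarrow> nat set set) \<Rightarrow> bool" where
  "random_biregular_graph M m n dL dR G \<longleftrightarrow>
     G \<in> measurable M (count_space (biregular_graphs m n dL dR)) \<and>
     distr M (count_space (biregular_graphs m n dL dR)) G =
       uniform_count_measure (biregular_graphs m n dL dR)"

definition adjacency_matrix :: "nat \<Rightarrow> nat set set \<Rightarrow> real mat" where
  "adjacency_matrix N E = Matrix.mat N N (\<lambda>(i, j). if {i, j} \<in> E then 1 else 0)"

(* Used for symmetric A only: then the char_poly has exactly dim_row A real roots, counted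
   with multiplicity, and these are the eigenvalues.  The distr merely replaces the discrete
   sigma algebra of a pmf by the Borel one.  For a 0 x 0 matrix the value is an unspecified
   probability measure. *)
definition esd :: "real mat \<Rightarrow> real measure" where
  "esd A = distr (measure_pmf (pmf_of_multiset (proots (char_poly A)))) borel (\<lambda>x. x)"

(* Marchenko-Pastur law with ratio 1/y, for y >= 1 (so there is no atom at 0). *)
definition marchenko_pastur :: "real \<Rightarrow> real measure" where
  "marchenko_pastur y =
     (let a = 1 - y powr (-1/2); b = 1 + y powr (-1/2)
      in density lborel
           (\<lambda>x. ennreal (indicator {a\<^sup>2..b\<^sup>2} x *
                  (y / (2 * pi * x) * sqrt ((b\<^sup>2 - x) * (x - a\<^sup>2))))))"

definition converges_almost_surely ::
  "'w measure \<Rightarrow> (nat \<Rightarrow> 'w \<Rightarrow> real measure) \<Rightarrow> real measure \<Rightarrow> bool" where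
  "converges_almost_surely M \<mu> \<nu> \<longleftrightarrow>
     (\<forall>f :: real \<Rightarrow> real. continuous_on UNIV f \<and> bounded (range f) \<longrightarrow>
        (AE \<omega> in M. (\<lambda>k. integral\<^sup>L (\<mu> k \<omega>) f) \<longlonglongrightarrow> integral\<^sup>L \<nu> f))"

end

theory Submission
  imports
    Defs
    "Jordan_Normal_Form.Schur_Decomposition"
begin

text \<open>The numbers of non-backtracking walks of length \<open>2 * r\<close> between right vertices are, up to the
  factor \<open>dR ^ r\<close>, polynomials \<open>Q\<^sub>r\<close> in \<open>X\<^sup>T X / dR\<close>. The polynomials satisfy a three-term recurrence whose
  coefficients converge to those of the orthogonal polynomials of the Marchenko-Pastur law. Hence the
  moments converge as soon as the integrals of the \<open>Q\<^sub>r\<close>, \<open>r > 0\<close>, tend to \<open>0\<close>, i.e. as soon as there are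
  few closed non-backtracking walks. Their trace contains a cycle, and the trace of two of them has at least
  as many edges as vertices. A switching argument shows that a fixed set of \<open>q\<close> edges lies in the random
  graph with probability at most \<open>(2 * dL / n) ^ q\<close> for large \<open>n\<close>, so the second moment of their number is bounded by
  a power of \<open>dR\<close>, that is by \<open>n\<^bsup>o(1)\<^esup>\<close>, and Chebyshev's inequality and Borel-Cantelli apply whatever the joint
  distribution. The second moment is needed because the first one only gives probabilities of order
  \<open>n\<^bsup>-1+o(1)\<^esup>\<close>, which are not summable.\<close>

section \<open>Biregular graphs and switchings\<close>

text \<open>A plain moment computation would have to count the closed walks that trace trees, which
  dominate the trace of every power of \<open>X^T X\<close>. In the non-backtracking basis these
  walks are absorbed into the recurrence: the limit law enters only through its orthogonal
  polynomials, and only cycles remain to be estimated.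

  That estimate is balanced so that \<open>n\<close> cancels. An edge costs a factor of order
  \<open>dL / n\<close>, a vertex of a trace has \<open>m + n\<close> choices, and
  \<open>(m + n) * dL / n = dL + dR\<close> because \<open>m * dL = n * dR\<close>. A trace with at
  least as many edges as vertices therefore contributes only a power of the degrees.

  The exponents are chosen as follows: the second moment is at most \<open>n powr (1/4)\<close>, the
  threshold is \<open>n powr (7/8)\<close>, so the failure probability is at most
  \<open>n powr (-3/2)\<close>, while the threshold is still negligible against the \<open>n\<close>
  eigenvalues.

  For the limit law, the substitution \<open>x = 1 + s^2 - 2 * s * cos t\<close> with
  \<open>s = y powr (-1/2)\<close> turns the orthogonal polynomials into combinations of Chebyshev
  polynomials of the second kind, and their integrals into trigonometric ones.\<close>

definition neighbours :: "'a set set \<Rightarrow> 'a \<Rightarrow> 'a set" where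
  "neighbours E v = {w. {v, w} \<in> E}"

lemma in_neighbours: "w \<in> neighbours E v \<longleftrightarrow> {v, w} \<in> E"
  by (simp add: neighbours_def)

lemma biregular_edge_cases:
  assumes "E \<in> biregular_graphs m n dL dR" "e \<in> E"
  obtains u v where "e = {u, v}" "u < m" "m \<le> v" "v < m + n"
proof -
  have "e \<in> {{u, v} | u v. u \<in> {..<m} \<and> v \<in> {m..<m + n}}"
    using assms unfolding biregular_graphs_def by blast
  then show ?thesis using that by auto
qed

lemma biregular_edgeD:
  assumes "E \<in> biregular_graphs m n dL dR" "{a, b} \<in> E"
  shows "a < m \<and> m \<le> b \<and> b < m + n \<or> b < m \<and> m \<le> a \<and> a < m + n"
proof -
  obtain u v where "{a, b} = {u, v}" "u < m" "m \<le> v" "v < m + n"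
    using assms by (rule biregular_edge_cases)
  then show ?thesis by (auto simp: doubleton_eq_iff)
qed

lemma biregular_subset_Pow:
  assumes "E \<in> biregular_graphs m n dL dR"
  shows "E \<subseteq> Pow {..<m+n}"
proof
  fix e assume "e \<in> E"
  with assms obtain u v where "e = {u, v}" "u < m" "m \<le> v" "v < m + n"
    by (rule biregular_edge_cases)
  then show "e \<in> Pow {..<m+n}" by auto
qed

lemma biregular_finite: "E \<in> biregular_graphs m n dL dR \<Longrightarrow> finite E"
  by (rule finite_subset[OF biregular_subset_Pow]) auto

lemma finite_biregular_graphs: "finite (biregular_graphs m n dL dR)"
  by (rule finite_subset[of _ "Pow (Pow {..<m+n})"]) (use biregular_subset_Pow in blast, simp)

lemma biregular_neighbours_left:
  assumes "E \<in> biregular_graphs m n dL dR" "u < m"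
  shows "neighbours E u \<subseteq> {m..<m+n}" "card (neighbours E u) = dL"
proof -
  show sub: "neighbours E u \<subseteq> {m..<m+n}"
    using assms by (auto simp: in_neighbours dest!: biregular_edgeD)
  have "bij_betw (\<lambda>w. {u, w}) (neighbours E u) {e \<in> E. u \<in> e}"
  proof (rule bij_betwI')
    fix e assume "e \<in> {e \<in> E. u \<in> e}"
    then have e: "e \<in> E" "u \<in> e" by auto
    from assms(1) e(1) obtain a b where "e = {a, b}" by (rule biregular_edge_cases)
    with e show "\<exists>w\<in>neighbours E u. e = {u, w}"
      by (auto simp: in_neighbours insert_commute)
  qed (auto simp: in_neighbours doubleton_eq_iff)
  then have "card (neighbours E u) = vertex_degree E u"
    unfolding vertex_degree_def by (rule bij_betw_same_card)
  then show "card (neighbours E u) = dL"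
    using assms unfolding biregular_graphs_def by auto
qed

lemma biregular_neighbours_right:
  assumes "E \<in> biregular_graphs m n dL dR" "m \<le> v" "v < m + n"
  shows "neighbours E v \<subseteq> {..<m}" "card (neighbours E v) = dR"
proof -
  show sub: "neighbours E v \<subseteq> {..<m}"
    using assms by (auto simp: in_neighbours dest!: biregular_edgeD)
  have "bij_betw (\<lambda>w. {v, w}) (neighbours E v) {e \<in> E. v \<in> e}"
  proof (rule bij_betwI')
    fix e assume "e \<in> {e \<in> E. v \<in> e}"
    then have e: "e \<in> E" "v \<in> e" by auto
    from assms(1) e(1) obtain a b where "e = {a, b}" by (rule biregular_edge_cases)
    with e show "\<exists>w\<in>neighbours E v. e = {v, w}"
      by (auto simp: in_neighbours insert_commute)
  qed (auto simp: in_neighbours doubleton_eq_iff)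
  then have "card (neighbours E v) = vertex_degree E v"
    unfolding vertex_degree_def by (rule bij_betw_same_card)
  then show "card (neighbours E v) = dR"
    using assms unfolding biregular_graphs_def by auto
qed

lemma biregular_neighbours_finite:
  assumes "E \<in> biregular_graphs m n dL dR"
  shows "finite (neighbours E v)"
proof (rule finite_subset)
  show "neighbours E v \<subseteq> {..<m+n}"
    using assms by (auto simp: in_neighbours dest!: biregular_edgeD)
qed auto

lemma neighbours_sym: "w \<in> neighbours E v \<longleftrightarrow> v \<in> neighbours E w"
  by (simp add: in_neighbours insert_commute)

text \<open>Each edge is oriented from left to right, because a switching has to know which endpoint
  lies on which side. Counting arcs from both classes gives \<open>m * dL = n * dR\<close>.\<close>

definition arcs :: "nat \<Rightarrow> nat set set \<Rightarrow> (nat \<times> nat) set" where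
  "arcs m E = {(u, v). u < m \<and> m \<le> v \<and> {u, v} \<in> E}"

lemma arcs_eq_right:
  assumes "E \<in> biregular_graphs m n dL dR"
  shows "arcs m E = prod.swap ` (SIGMA v:{m..<m+n}. neighbours E v)"
proof -
  have "v < m + n" if "u < m" "{u, v} \<in> E" for u v
    using biregular_neighbours_left(1)[OF assms that(1)] that(2) by (auto simp: in_neighbours)
  moreover have "u < m" if "m \<le> v" "v < m + n" "u \<in> neighbours E v" for u v
    using biregular_neighbours_right(1)[OF assms that(1,2)] that(3) by auto
  ultimately show ?thesis
    unfolding arcs_def by (force simp: in_neighbours insert_commute image_iff)
qed

lemma arcs_eq_left:
  assumes "E \<in> biregular_graphs m n dL dR"
  shows "arcs m E = (SIGMA u:{..<m}. neighbours E u)"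
proof -
  have "m \<le> v" if "u < m" "v \<in> neighbours E u" for u v
    using biregular_neighbours_left(1)[OF assms that(1)] that(2) by auto
  then show ?thesis
    unfolding arcs_def by (auto simp: in_neighbours)
qed

lemma card_arcs_right:
  assumes "E \<in> biregular_graphs m n dL dR"
  shows "card (arcs m E) = n * dR"
proof -
  have "card (arcs m E) = card (SIGMA v:{m..<m+n}. neighbours E v)"
    unfolding arcs_eq_right[OF assms] by (rule card_image) (auto simp: inj_on_def)
  also have "\<dots> = (\<Sum>v\<in>{m..<m+n}. card (neighbours E v))"
    using biregular_neighbours_finite[OF assms] by simp
  also have "\<dots> = (\<Sum>v\<in>{m..<m+n}. dR)"
    by (rule sum.cong) (auto simp: biregular_neighbours_right(2)[OF assms])
  finally show ?thesis by simp
qed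

lemma card_arcs_left:
  assumes "E \<in> biregular_graphs m n dL dR"
  shows "card (arcs m E) = m * dL"
proof -
  have "card (arcs m E) = (\<Sum>u\<in>{..<m}. card (neighbours E u))"
    unfolding arcs_eq_left[OF assms]
    using biregular_neighbours_finite[OF assms] by simp
  also have "\<dots> = (\<Sum>u\<in>{..<m}. dL)"
    by (rule sum.cong) (auto simp: biregular_neighbours_left(2)[OF assms])
  finally show ?thesis by simp
qed

lemma finite_arcs: "E \<in> biregular_graphs m n dL dR \<Longrightarrow> finite (arcs m E)"
  using biregular_neighbours_finite by (auto simp: arcs_eq_left)

section \<open>Switchings and the probability of containing given edges\<close>

definition switch :: "'a \<Rightarrow> 'a \<Rightarrow> 'a set set \<Rightarrow> 'a \<Rightarrow> 'a \<Rightarrow> 'a set set" where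
  "switch u v E u' v' = (E - {{u, v}, {u', v'}}) \<union> {{u, v'}, {u', v}}"

lemma vertex_degree_switch:
  assumes "finite E" "distinct [u, v, u', v']"
    and "{u, v} \<in> E" "{u', v'} \<in> E" "{u, v'} \<notin> E" "{u', v} \<notin> E"
  shows "vertex_degree (switch u v E u' v') x = vertex_degree E x"
proof -
  define f :: "nat set \<Rightarrow> nat" where "f = (\<lambda>e. if x \<in> e then 1 else 0)"
  have deg: "vertex_degree H x = sum f H" if "finite H" for H
  proof -
    have "sum f H = sum f {e \<in> H. x \<in> e}"
      by (rule sum.mono_neutral_right) (use that in \<open>auto simp: f_def\<close>)
    then show ?thesis by (simp add: vertex_degree_def f_def)
  qed
  define E0 where "E0 = E - {{u, v}, {u', v'}}"
  have ne: "{u, v} \<noteq> {u', v'}" "{u, v'} \<noteq> {u', v}"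
    using assms(2) by (auto simp: doubleton_eq_iff)
  have E: "E = insert {u, v} (insert {u', v'} E0)"
    using assms by (auto simp: E0_def)
  have fin: "finite E0" using assms(1) by (simp add: E0_def)
  have "sum f E = f {u, v} + (f {u', v'} + sum f E0)"
    unfolding E using fin ne(1) by (subst sum.insert; simp add: E0_def)
  moreover have "sum f (switch u v E u' v') = f {u, v'} + (f {u', v} + sum f E0)"
  proof -
    have "switch u v E u' v' = insert {u, v'} (insert {u', v} E0)"
      by (auto simp: switch_def E0_def)
    then show ?thesis
      using fin ne(2) assms(5,6) by (simp add: E0_def)
  qed
  moreover have "f {u, v} + f {u', v'} = f {u, v'} + f {u', v}"
    using assms(2) by (auto simp: f_def)
  ultimately have "sum f (switch u v E u' v') = sum f E" by simp
  then show ?thesis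
    using assms(1) by (simp add: deg switch_def)
qed

lemma switch_in_biregular_graphs:
  assumes "E \<in> biregular_graphs m n dL dR"
    and "u < m" "u' < m" "m \<le> v" "m \<le> v'" "u \<noteq> u'" "v \<noteq> v'"
    and "{u, v} \<in> E" "{u', v'} \<in> E" "{u, v'} \<notin> E" "{u', v} \<notin> E"
  shows "switch u v E u' v' \<in> biregular_graphs m n dL dR"
proof -
  have d: "distinct [u, v, u', v']" using assms by auto
  have vn: "v < m + n" "v' < m + n"
    using biregular_neighbours_left(1)[OF assms(1), of u] biregular_neighbours_left(1)[OF assms(1), of u'] assms
    by (auto simp: in_neighbours)
  have deg: "vertex_degree (switch u v E u' v') x = vertex_degree E x" for x
    by (rule vertex_degree_switch) (use d assms biregular_finite in auto)
  have "switch u v E u' v' \<subseteq> {{u, v} | u v. u \<in> {..<m} \<and> v \<in> {m..<m + n}}"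
    using assms(1-5) vn unfolding switch_def biregular_graphs_def by auto
  then show ?thesis
    using assms(1) unfolding biregular_graphs_def by (simp add: deg)
qed

text \<open>Switching along the two new edges undoes a switching. The original graph is thus
  determined by the new one together with \<open>u'\<close> and \<open>v'\<close>, which makes the
  counting map in the next lemma injective.\<close>

lemma switch_switch:
  assumes "{u, v} \<in> E" "{u', v'} \<in> E" "{u, v'} \<notin> E" "{u', v} \<notin> E"
  shows "switch u v' (switch u v E u' v') u' v = E"
  using assms unfolding switch_def by auto

text \<open>A switching along \<open>{u, v}\<close> destroys this edge and keeps all other edges of \<open>F\<close>; there are
  nearly \<open>n * dR\<close> of them, but a graph arises from at most \<open>dL * dR\<close> switchings.\<close>

lemma switching_step:
  assumes F: "finite F" "card F \<le> c" "{u, v} \<in> F" "u < m" "m \<le> v" "v < m + n"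
    and large: "2 * (c + 2 * dL * dR) \<le> n * dR"
  shows "n * dR * card {E \<in> biregular_graphs m n dL dR. F \<subseteq> E}
          \<le> 2 * dL * dR * card {E \<in> biregular_graphs m n dL dR. F - {{u, v}} \<subseteq> E}"
proof -
  define A where "A = {E \<in> biregular_graphs m n dL dR. F \<subseteq> E}"
  define B where "B = {E \<in> biregular_graphs m n dL dR. F - {{u, v}} \<subseteq> E}"
  define T where "T = (\<lambda>E. {(u', v') \<in> arcs m E. {u', v'} \<notin> F \<and> {u, v'} \<notin> E \<and> {u', v} \<notin> E})"
  have finA: "finite A" and finB: "finite B"
    using finite_biregular_graphs by (auto simp: A_def B_def)
  have finT: "finite (T E)" if "E \<in> A" for E
  proof (rule finite_subset)
    show "T E \<subseteq> arcs m E" by (auto simp: T_def)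
    show "finite (arcs m E)" using that finite_arcs by (auto simp: A_def)
  qed
  have cardT: "n * dR - (c + 2 * dL * dR) \<le> card (T E)" if "E \<in> A" for E
  proof -
    have E: "E \<in> biregular_graphs m n dL dR" "F \<subseteq> E" using that by (auto simp: A_def)
    \<comment> \<open>Three kinds of arcs cannot be used: those in \<open>F\<close>, which must
      survive; those with \<open>{u, v'}\<close> already present, given by a path from
      \<open>u\<close> over \<open>v'\<close> to \<open>u'\<close>; and those with
      \<open>{u', v}\<close> already present, given by a path from \<open>v\<close> over
      \<open>u'\<close>.\<close>
    let ?B1 = "{(u', v') \<in> arcs m E. {u', v'} \<in> F}"
    let ?B2 = "SIGMA v':neighbours E u. neighbours E v'"
    let ?B3 = "SIGMA u':neighbours E v. neighbours E u'"
    have "card ?B1 \<le> card F"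
    proof (rule card_inj_on_le[where f = "\<lambda>(a, b). {a, b}"])
      show "inj_on (\<lambda>(a, b). {a, b}) ?B1"
        by (auto simp: inj_on_def arcs_def doubleton_eq_iff)
    qed (use F in auto)
    then have b1: "card ?B1 \<le> c" using F by simp
    have "card ?B2 = (\<Sum>v'\<in>neighbours E u. card (neighbours E v'))"
      using biregular_neighbours_finite[OF E(1)] by simp
    also have "\<dots> = (\<Sum>v'\<in>neighbours E u. dR)"
      using biregular_neighbours_left(1)[OF E(1) F(4)] biregular_neighbours_right(2)[OF E(1)]
      by (intro sum.cong) auto
    finally have b2: "card ?B2 = dL * dR"
      using biregular_neighbours_left(2)[OF E(1) F(4)] by simp
    have "card ?B3 = (\<Sum>u'\<in>neighbours E v. card (neighbours E u'))"
      using biregular_neighbours_finite[OF E(1)] by simp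
    also have "\<dots> = (\<Sum>u'\<in>neighbours E v. dL)"
      using biregular_neighbours_right(1)[OF E(1) F(5,6)] biregular_neighbours_left(2)[OF E(1)]
      by (intro sum.cong) auto
    finally have b3: "card ?B3 = dR * dL"
      using biregular_neighbours_right(2)[OF E(1) F(5,6)] by simp
    have fin: "finite ?B1" "finite ?B2" "finite ?B3"
      using finite_arcs[OF E(1)] biregular_neighbours_finite[OF E(1)]
      by (auto intro: finite_subset[where B = "arcs m E"])
    have "arcs m E \<subseteq> T E \<union> (?B1 \<union> prod.swap ` ?B2 \<union> ?B3)"
      by (auto simp: T_def arcs_def in_neighbours insert_commute image_iff)
    then have "card (arcs m E) \<le> card (T E \<union> (?B1 \<union> prod.swap ` ?B2 \<union> ?B3))"
      using finT[OF that] fin by (intro card_mono) auto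
    also have "\<dots> \<le> card (T E) + (card ?B1 + card (prod.swap ` ?B2) + card ?B3)"
      by (meson card_Un_le order_trans add_le_mono le_refl)
    also have "card (prod.swap ` ?B2) \<le> card ?B2"
      by (rule card_image_le[OF fin(2)])
    finally show ?thesis
      using b1 b2 b3 card_arcs_right[OF E(1)] by (simp add: algebra_simps)
  qed
  define \<Phi> where "\<Phi> = (\<lambda>(E, (u', v')). (switch u v E u' v', (u', v')))"
  have inj: "inj_on \<Phi> (SIGMA E:A. T E)"
  proof (rule inj_onI)
    fix p q assume p: "p \<in> Sigma A T" and q: "q \<in> Sigma A T" and eq: "\<Phi> p = \<Phi> q"
    obtain E1 a b where p': "p = (E1, (a, b))" by (metis prod.collapse)
    obtain E2 a' b' where q': "q = (E2, (a', b'))" by (metis prod.collapse)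
    have ab: "a = a'" "b = b'" and sw: "switch u v E1 a b = switch u v E2 a b"
      using eq by (auto simp: \<Phi>_def p' q')
    have "switch u b (switch u v E1 a b) a v = E1"
      by (rule switch_switch) (use p F in \<open>auto simp: p' T_def A_def arcs_def\<close>)
    moreover have "switch u b (switch u v E2 a b) a v = E2"
      by (rule switch_switch) (use q F ab in \<open>auto simp: q' T_def A_def arcs_def\<close>)
    ultimately have "E1 = E2" unfolding sw by (rule trans[OF sym])
    with ab show "p = q" by (simp only: p' q')
  qed
  \<comment> \<open>In the new graph \<open>u'\<close> is adjacent to \<open>v\<close> and
    \<open>v'\<close> to \<open>u\<close>, so each graph carries only \<open>dR * dL\<close>
    possible pairs \<open>(u', v')\<close>.\<close>
  have img: "\<Phi> ` (SIGMA E:A. T E) \<subseteq> (SIGMA E:B. neighbours E v \<times> neighbours E u)"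
  proof
    fix z assume "z \<in> \<Phi> ` (SIGMA E:A. T E)"
    then obtain E u' v' where z: "z = (switch u v E u' v', (u', v'))"
      and E: "E \<in> biregular_graphs m n dL dR" "F \<subseteq> E"
      and T: "u' < m" "m \<le> v'" "{u', v'} \<in> E" "{u', v'} \<notin> F" "{u, v'} \<notin> E" "{u', v} \<notin> E"
      by (auto simp: \<Phi>_def A_def T_def arcs_def)
    have uv: "{u, v} \<in> E" using E F by auto
    have "u \<noteq> u'" "v \<noteq> v'" using T uv by auto
    then have "switch u v E u' v' \<in> biregular_graphs m n dL dR"
      using E F T uv by (intro switch_in_biregular_graphs) auto
    moreover have "F - {{u, v}} \<subseteq> switch u v E u' v'"
      using E T by (auto simp: switch_def)
    ultimately show "z \<in> (SIGMA E:B. neighbours E v \<times> neighbours E u)"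
      by (auto simp: z B_def in_neighbours switch_def insert_commute)
  qed
  have "(\<Sum>E\<in>A. card (T E)) = card (SIGMA E:A. T E)"
    using finA finT by simp
  also have "\<dots> \<le> card (SIGMA E:B. neighbours E v \<times> neighbours E u)"
    by (rule card_inj_on_le[OF inj img])
      (use finB biregular_neighbours_finite in \<open>auto simp: B_def intro!: finite_SigmaI\<close>)
  also have "\<dots> = (\<Sum>E\<in>B. card (neighbours E v \<times> neighbours E u))"
    by (subst card_SigmaI) (use finB biregular_neighbours_finite in \<open>auto simp: B_def\<close>)
  also have "\<dots> = (\<Sum>E\<in>B. dR * dL)"
    by (rule sum.cong)
      (auto simp: B_def card_cartesian_product biregular_neighbours_left(2)[OF _ F(4)]
        biregular_neighbours_right(2)[OF _ F(5,6)])
  finally have 1: "(\<Sum>E\<in>A. card (T E)) \<le> card B * (dR * dL)" by simp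
  \<comment> \<open>By \<open>large\<close> the unusable arcs are at most half of all arcs; this is
    the origin of the factor 2.\<close>
  have "card A * (n * dR) \<le> 2 * (\<Sum>E\<in>A. card (T E))"
  proof -
    have "n * dR \<le> 2 * card (T E)" if "E \<in> A" for E
    proof -
      have "N \<le> 2 * t" if "N - K \<le> t" "2 * K \<le> N" for N K t :: nat
        using that by linarith
      from this[OF cardT[OF that] large] show ?thesis .
    qed
    then have "(\<Sum>E\<in>A. n * dR) \<le> (\<Sum>E\<in>A. 2 * card (T E))"
      by (rule sum_mono)
    then show ?thesis by (simp add: sum_distrib_left)
  qed
  also have "\<dots> \<le> 2 * (card B * (dR * dL))"
    using 1 by (rule mult_le_mono2)
  finally have "n * dR * card A \<le> 2 * dL * dR * card B"
    by (simp only: ac_simps)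
  then show ?thesis
    unfolding A_def B_def .
qed

text \<open>The edges of \<open>F\<close> are given up one at a time, each at the price of one
  switching step, in which \<open>dR\<close> cancels. The bound \<open>c\<close>, in place of
  \<open>card F\<close>, keeps the size condition the same while \<open>F\<close> shrinks.\<close>

lemma card_supergraphs_le:
  assumes "0 < dR" "0 < n"
    and "F \<subseteq> {{u, v} | u v. u < m \<and> m \<le> v \<and> v < m + n}"
    and "card F \<le> c" and large: "2 * (c + 2 * dL * dR) \<le> n * dR"
  shows "real (card {E \<in> biregular_graphs m n dL dR. F \<subseteq> E})
          \<le> (2 * real dL / real n) ^ card F * real (card (biregular_graphs m n dL dR))"
proof -
  have "finite F"
    by (rule finite_subset[of _ "Pow {..<m+n}"]) (use assms(3) in auto)
  then show ?thesis using assms(3,4)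
  proof (induction F rule: finite_induct)
    case empty
    then show ?case by simp
  next
    case (insert e F)
    then obtain u v where e: "e = {u, v}" "u < m" "m \<le> v" "v < m + n" by auto
    have "n * dR * card {E \<in> biregular_graphs m n dL dR. insert e F \<subseteq> E}
          \<le> 2 * dL * dR * card {E \<in> biregular_graphs m n dL dR. insert e F - {{u, v}} \<subseteq> E}"
      by (rule switching_step) (use insert e large in auto)
    also have "insert e F - {{u, v}} = F" using insert e by auto
    finally have "n * card {E \<in> biregular_graphs m n dL dR. insert e F \<subseteq> E}
          \<le> 2 * dL * card {E \<in> biregular_graphs m n dL dR. F \<subseteq> E}"
      using assms(1) by (simp add: algebra_simps)
    then have "real (n * card {E \<in> biregular_graphs m n dL dR. insert e F \<subseteq> E})
          \<le> real (2 * dL * card {E \<in> biregular_graphs m n dL dR. F \<subseteq> E})"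
      by (rule of_nat_mono)
    then have "real (card {E \<in> biregular_graphs m n dL dR. insert e F \<subseteq> E})
          \<le> (2 * real dL / real n) * real (card {E \<in> biregular_graphs m n dL dR. F \<subseteq> E})"
      using assms(2) by (simp add: field_simps)
    also have "\<dots> \<le> (2 * real dL / real n) *
        ((2 * real dL / real n) ^ card F * real (card (biregular_graphs m n dL dR)))"
      by (rule mult_left_mono[OF insert.IH]) (use insert in auto)
    finally show ?case using insert by (simp add: algebra_simps)
  qed
qed

section \<open>Non-backtracking walks\<close>

fun nonbacktracking :: "'a list \<Rightarrow> bool" where
  "nonbacktracking (u # v # w # p) \<longleftrightarrow> u \<noteq> w \<and> nonbacktracking (v # w # p)"
| "nonbacktracking _ \<longleftrightarrow> True"

fun edges :: "'a list \<Rightarrow> 'a set set" where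
  "edges (u # v # p) = insert {u, v} (edges (v # p))"
| "edges _ = {}"

lemma finite_edges [simp]: "finite (edges p)"
  by (induction p rule: edges.induct) auto

lemma Union_edges_subset: "\<Union>(edges p) \<subseteq> set p"
  by (induction p rule: edges.induct) auto

lemma card_edges_le: "card (edges p) \<le> length p - 1"
proof (induction p rule: edges.induct)
  case (1 u v p)
  have "card (edges (u # v # p)) \<le> Suc (card (edges (v # p)))"
    by (simp add: card_insert_if)
  with 1 show ?case by simp
qed auto

lemma edges_append: "edges (xs @ [c] @ ys) = edges (xs @ [c]) \<union> edges (c # ys)"
proof (induction xs)
  case (Cons x xs)
  then show ?case by (cases xs) auto
qed simp

lemma edges_rev: "edges (rev p) = edges p"
proof (induction p rule: edges.induct)
  case (1 u v p)
  have "edges (rev (u # v # p)) = edges (rev p @ [v]) \<union> edges [v, u]"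
    using edges_append[of "rev p" v "[u]"] by simp
  with 1 show ?case by (auto simp: insert_commute)
qed auto

section \<open>Traces with at least as many edges as vertices\<close>

text \<open>For a connected graph this means that it contains a cycle.\<close>

definition edge_rich :: "'a set \<Rightarrow> 'a set set \<Rightarrow> bool" where
  "edge_rich V F \<longleftrightarrow> finite V \<and> finite F \<and> \<Union>F \<subseteq> V \<and> card V \<le> card F"

text \<open>Along a walk that starts in \<open>V\<close>, a step adds at most one vertex, and
  whenever it does, its edge leaves \<open>V\<close> and hence is not in \<open>F\<close>. So edges
  never fall behind vertices.\<close>

lemma edge_rich_extend:
  assumes "edge_rich V F" "p \<noteq> []" "hd p \<in> V"
  shows "edge_rich (V \<union> set p) (F \<union> edges p)"
  using assms
proof (induction p arbitrary: V F rule: edges.induct)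
  case (1 u v p)
  have "edge_rich (insert v V) (insert {u, v} F)"
  proof (cases "v \<in> V")
    case True
    then show ?thesis
      using 1(2,4) by (auto simp: edge_rich_def insert_absorb card_insert_if)
  next
    case False
    then have "{u, v} \<notin> F" using 1(2) by (auto simp: edge_rich_def)
    then show ?thesis
      using 1(2,4) False by (auto simp: edge_rich_def)
  qed
  from 1(1)[OF this] have "edge_rich (insert v V \<union> set (v # p)) (insert {u, v} F \<union> edges (v # p))"
    by simp
  moreover have "insert v V \<union> set (v # p) = V \<union> set (u # v # p)"
    using 1(4) by auto
  ultimately show ?case by simp
qed (auto simp: insert_absorb)

text \<open>The walk is cut at a vertex \<open>c\<close> of \<open>V\<close>. Both pieces can be
  walked from \<open>c\<close>, the first one in reverse.\<close>

lemma edge_rich_extend_meeting: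
  assumes "edge_rich V F" "V \<inter> set p \<noteq> {}"
  shows "edge_rich (V \<union> set p) (F \<union> edges p)"
proof -
  obtain c where c: "c \<in> V" "c \<in> set p" using assms(2) by auto
  then obtain xs ys where p: "p = xs @ [c] @ ys" by (metis split_list append_Cons append_Nil)
  have "edge_rich (V \<union> set (c # ys)) (F \<union> edges (c # ys))"
    by (rule edge_rich_extend) (use assms c in auto)
  then have "edge_rich (V \<union> set (c # ys) \<union> set (rev (xs @ [c]))) (F \<union> edges (c # ys) \<union> edges (rev (xs @ [c])))"
    by (rule edge_rich_extend) auto
  moreover have "V \<union> set (c # ys) \<union> set (rev (xs @ [c])) = V \<union> set p"
    by (auto simp: p)
  moreover have "F \<union> edges (c # ys) \<union> edges (rev (xs @ [c])) = F \<union> edges p"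
    using edges_append[of xs c ys] edges_rev[of "xs @ [c]"] by (simp add: p Un_ac)
  ultimately show ?thesis by simp
qed

text \<open>A common edge would be contained in \<open>V \<inter> W = {}\<close>, hence empty, which
  \<open>{} \<notin> F\<close> excludes. So both cardinalities add up.\<close>

lemma edge_rich_disjoint_union:
  assumes "edge_rich V F" "edge_rich W H" "V \<inter> W = {}" "{} \<notin> F"
  shows "edge_rich (V \<union> W) (F \<union> H)"
proof -
  have "F \<inter> H = {}"
  proof (rule ccontr)
    assume "F \<inter> H \<noteq> {}"
    then obtain e where e: "e \<in> F" "e \<in> H" by auto
    then have "e \<subseteq> V \<inter> W" using assms(1,2) by (auto simp: edge_rich_def)
    with e assms show False by auto
  qed
  then show ?thesis
    using assms by (auto simp: edge_rich_def card_Un_disjoint)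
qed

lemma card_edges_distinct: "distinct p \<Longrightarrow> card (edges p) = length p - 1"
proof (induction p rule: edges.induct)
  case (1 u v p)
  have "{u, v} \<notin> edges (v # p)"
    using Union_edges_subset[of "v # p"] 1(2) by auto
  with 1 show ?case by simp
qed auto

lemma nonbacktracking_Cons: "nonbacktracking (u # p) \<Longrightarrow> nonbacktracking p"
  by (cases "u # p" rule: nonbacktracking.cases) auto

lemma empty_notin_edges: "{} \<notin> edges p"
  by (induction p rule: edges.induct) auto

text \<open>The edge that closes a path to a cycle is new, because the walk does not backtrack.\<close>

lemma edge_rich_nonbacktracking:
  assumes "nonbacktracking p" "\<not> distinct p" "\<And>x. {x} \<notin> edges p"
  shows "edge_rich (set p) (edges p)"
  using assms
proof (induction p)
  case (Cons a q)
  have nbq: "nonbacktracking q" using Cons.prems by (blast dest: nonbacktracking_Cons)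
  from Cons.prems obtain b q' where q: "q = b # q'" by (cases q) auto
  have noloop: "\<And>x. {x} \<notin> edges q" using Cons.prems(3) by (auto simp: q)
  show ?case
  proof (cases "distinct q")
    case False
    have "edge_rich (set q) (edges q)" using Cons.IH nbq False noloop by blast
    then have "edge_rich (set q \<union> set [b, a]) (edges q \<union> edges [b, a])"
      by (rule edge_rich_extend) (auto simp: q)
    moreover have "set q \<union> set [b, a] = set (a # q)" by (auto simp: q)
    moreover have "edges q \<union> edges [b, a] = edges (a # q)" by (auto simp: q insert_commute)
    ultimately show ?thesis by simp
  next
    \<comment> \<open>Here \<open>q\<close> is a path, with one edge fewer than vertices, and
      \<open>a\<close> repeats one of its vertices. One new edge restores the balance.\<close>
    case True
    with Cons.prems have a: "a \<in> set q" by simp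
    have ab: "a \<noteq> b" using Cons.prems(3)[of a] by (auto simp: q)
    have "{a, b} \<notin> edges q"
    proof
      assume asm: "{a, b} \<in> edges q"
      from a ab obtain c q'' where q': "q' = c # q''" by (cases q') (auto simp: q)
      have "a \<noteq> c" using Cons.prems(1) by (simp add: q q')
      \<comment> \<open>As \<open>a\<close> differs from \<open>c\<close>, the edge
        \<open>{a, b}\<close> is not the first edge of \<open>q\<close>, so \<open>b\<close> would
        occur again later in the path \<open>q\<close>.\<close>
      then have "{a, b} \<in> edges (c # q'')" using asm ab by (auto simp: q q' doubleton_eq_iff)
      then have "b \<in> set (c # q'')" using Union_edges_subset[of "c # q''"] by auto
      with True show False by (simp add: q q')
    qed
    then have "card (edges (a # q)) = length q"
      using card_edges_distinct[OF True] by (simp add: q)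
    moreover have "card (set (a # q)) = length q"
      using a True by (simp add: insert_absorb distinct_card)
    ultimately show ?thesis
      using Union_edges_subset[of "a # q"] by (auto simp: edge_rich_def)
  qed
qed simp

text \<open>This is what makes the second moment as good as the square of the first: disjoint traces
  add up, and if the traces meet, the balance of the first is preserved while the second is
  traversed.\<close>

lemma edge_rich_union:
  assumes "nonbacktracking p" "\<not> distinct p" "nonbacktracking q" "\<not> distinct q"
    and "\<And>x. {x} \<notin> edges p" "\<And>x. {x} \<notin> edges q"
  shows "edge_rich (set p \<union> set q) (edges p \<union> edges q)"
proof -
  have p: "edge_rich (set p) (edges p)" and q: "edge_rich (set q) (edges q)"
    using assms by (auto intro: edge_rich_nonbacktracking)
  show ?thesis
  proof (cases "set p \<inter> set q = {}")
    case True
    then show ?thesis using p q empty_notin_edges by (intro edge_rich_disjoint_union) auto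
  next
    case False
    then show ?thesis using p by (intro edge_rich_extend_meeting) auto
  qed
qed

text \<open>Appending a letter either repeats one of at most \<open>L\<close> earlier letters or costs a factor \<open>x\<close>.\<close>

lemma sum_power_card_set_le:
  fixes x :: real
  assumes "finite A" "0 \<le> x"
  shows "(\<Sum>l | set l \<subseteq> A \<and> length l = L. x ^ card (set l)) \<le> (real L + real (card A) * x) ^ L"
proof -
  have "(\<Sum>l | set l \<subseteq> A \<and> length l = k. x ^ card (set l)) \<le> (real L + real (card A) * x) ^ k"
    \<comment> \<open>The base of the power stays tied to the final length \<open>L\<close> while
      \<open>k\<close> grows, so that each letter contributes the same factor.\<close>
    if "k \<le> L" for k
    using that
  proof (induction k)
    case 0
    have "{l. set l \<subseteq> A \<and> length l = 0} = {[]}" by auto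
    then show ?case by simp
  next
    case (Suc k)
    let ?S = "\<lambda>k. {l. set l \<subseteq> A \<and> length l = k}"
    have fin: "finite (?S k)" using assms(1) by (rule finite_lists_length_eq)
    have bij: "bij_betw (\<lambda>(l, a). a # l) (?S k \<times> A) (?S (Suc k))"
      by (rule bij_betw_byWitness[where f' = "\<lambda>l. (tl l, hd l)"]) (auto simp: length_Suc_conv)
    have "(\<Sum>l\<in>?S (Suc k). x ^ card (set l)) = (\<Sum>z\<in>?S k \<times> A. x ^ card (set ((\<lambda>(l, a). a # l) z)))"
      using sum.reindex_bij_betw[OF bij, of "\<lambda>l. x ^ card (set l)"] by simp
    also have "\<dots> = (\<Sum>l\<in>?S k. \<Sum>a\<in>A. x ^ card (insert a (set l)))"
      by (subst sum.cartesian_product) (simp add: case_prod_unfold)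
    also have "\<dots> \<le> (\<Sum>l\<in>?S k. (real L + real (card A) * x) * x ^ card (set l))"
    proof (rule sum_mono)
      fix l assume l: "l \<in> ?S k"
      have "(\<Sum>a\<in>A. x ^ card (insert a (set l)))
          \<le> (\<Sum>a\<in>A. (if a \<in> set l then x ^ card (set l) else 0) + x * x ^ card (set l))"
        by (rule sum_mono) (use assms(2) in \<open>auto simp: insert_absorb\<close>)
      also have "\<dots> = real (card (A \<inter> set l)) * x ^ card (set l) + real (card A) * (x * x ^ card (set l))"
        using assms(1) by (simp add: sum.distrib sum.If_cases Int_def)
      also have "card (A \<inter> set l) \<le> L"
      proof -
        have "card (A \<inter> set l) \<le> card (set l)" by (intro card_mono) auto
        also have "\<dots> \<le> length l" by (rule card_length)
        finally show ?thesis using l Suc by simp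
      qed
      then have "real (card (A \<inter> set l)) * x ^ card (set l) + real (card A) * (x * x ^ card (set l))
          \<le> real L * x ^ card (set l) + real (card A) * (x * x ^ card (set l))"
        using assms(2) by (intro add_right_mono mult_right_mono) auto
      finally show "(\<Sum>a\<in>A. x ^ card (insert a (set l))) \<le> (real L + real (card A) * x) * x ^ card (set l)"
        by (simp add: algebra_simps)
    qed
    also have "\<dots> = (real L + real (card A) * x) * (\<Sum>l\<in>?S k. x ^ card (set l))"
      by (simp add: sum_distrib_left)
    also have "\<dots> \<le> (real L + real (card A) * x) * (real L + real (card A) * x) ^ k"
      using Suc assms(2) by (intro mult_left_mono) auto
    finally show ?case by simp
  qed
  then show ?thesis by simp
qed

section \<open>Recurrences for the numbers of non-backtracking walks\<close>

definition nb_walks :: "'a set set \<Rightarrow> nat \<Rightarrow> 'a \<Rightarrow> 'a \<Rightarrow> 'a list set" where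
  "nb_walks E s u v = {p. length p = Suc s \<and> hd p = u \<and> last p = v \<and> edges p \<subseteq> E \<and> nonbacktracking p}"

lemma set_subset_Union_edges: "2 \<le> length p \<Longrightarrow> set p \<subseteq> \<Union>(edges p)"
proof (induction p rule: edges.induct)
  case (1 u v p)
  then show ?case by (cases p) auto
qed auto

lemma finite_nb_walks:
  assumes "finite (\<Union>E)"
  shows "finite (nb_walks E s u v)"
proof (rule finite_subset)
  show "nb_walks E s u v \<subseteq> {p. set p \<subseteq> insert u (\<Union>E) \<and> length p = Suc s}"
  proof (cases s)
    case 0
    then show ?thesis by (auto simp: nb_walks_def length_Suc_conv)
  next
    case (Suc t)
    then show ?thesis
    proof (intro subsetI CollectI conjI)
      fix p x assume p: "p \<in> nb_walks E s u v"
      then show "length p = Suc s" by (simp add: nb_walks_def)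
      assume "x \<in> set p"
      then have "x \<in> \<Union>(edges p)"
        using set_subset_Union_edges[of p] p Suc by (auto simp: nb_walks_def)
      then show "x \<in> insert u (\<Union>E)" using p by (auto simp: nb_walks_def)
    qed
  qed
qed (use assms in \<open>auto intro: finite_lists_length_eq\<close>)

lemma nb_walks_0: "nb_walks E 0 u v = (if u = v then {[u]} else {})"
  by (auto simp: nb_walks_def length_Suc_conv)

lemma nb_walks_1: "nb_walks E (Suc 0) u v = (if v \<in> neighbours E u then {[u, v]} else {})"
  by (auto simp: nb_walks_def length_Suc_conv in_neighbours)

lemma nb_walks_step_cases:
  assumes "p \<in> nb_walks E s w v" "\<not> nonbacktracking (u # p)"
  obtains q where "p = w # u # q" "u # q \<in> nb_walks E (s - 1) u v" "{u, w} \<in> E"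
    "case q of [] \<Rightarrow> True | x # _ \<Rightarrow> x \<noteq> w"
proof -
  from assms(2) obtain a b q where p: "p = a # b # q"
    by (cases "u # p" rule: nonbacktracking.cases) auto
  have ub: "b = u" using assms by (auto simp: p nb_walks_def)
  have "a = w" using assms by (auto simp: p nb_walks_def)
  then show ?thesis using assms ub
    by (intro that[of q])
      (auto simp: p nb_walks_def insert_commute nonbacktracking_Cons[of w "u # q"] split: list.splits)
qed

text \<open>Putting \<open>u\<close> in front of a walk from a neighbour \<open>w\<close> either
  gives a non-backtracking walk, or the walk runs \<open>u\<close>, \<open>w\<close>,
  \<open>u\<close> and onwards. In the latter case deleting the first two steps leaves a walk from
  \<open>u\<close> that does not continue to \<open>w\<close>. For \<open>s = 1\<close> that
  remainder is \<open>[u]\<close>, which has no next vertex, so \<open>p ! 1\<close> must not be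
  consulted. For \<open>s = 0\<close> nothing can backtrack, and \<open>s - 1\<close> would be
  truncated.\<close>

lemma nb_walks_step:
  assumes finU: "finite (\<Union>E)"
  shows "(\<Sum>w\<in>neighbours E u. card (nb_walks E s w v)) = card (nb_walks E (Suc s) u v) +
    (if s = 0 then 0 else
      (\<Sum>p\<in>nb_walks E (s - 1) u v. card {w \<in> neighbours E u. s = 1 \<or> p ! 1 \<noteq> w}))"
proof -
  have finN: "finite (neighbours E u)"
    by (rule finite_subset[OF _ finU]) (auto simp: in_neighbours)
  define C where "C = (SIGMA w:neighbours E u. nb_walks E s w v)"
  define C1 where "C1 = {(w, p) \<in> C. nonbacktracking (u # p)}"
  define C2 where "C2 = {(w, p) \<in> C. \<not> nonbacktracking (u # p)}"
  have finC: "finite C" using finN finite_nb_walks[OF finU] by (auto simp: C_def)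
  have "(\<Sum>w\<in>neighbours E u. card (nb_walks E s w v)) = card C"
    unfolding C_def using finN finite_nb_walks[OF finU] by simp
  also have "C = C1 \<union> C2" by (auto simp: C1_def C2_def)
  also have "card (C1 \<union> C2) = card C1 + card C2"
    by (rule card_Un_disjoint) (use finC in \<open>auto simp: C1_def C2_def intro: finite_subset\<close>)
  also have "card C1 = card (nb_walks E (Suc s) u v)"
  proof (rule bij_betw_same_card, rule bij_betw_byWitness[where f' = "\<lambda>p. (p ! 1, tl p)"])
    show "\<forall>a\<in>C1. ((\<lambda>(w, p). u # p) a ! 1, tl ((\<lambda>(w, p). u # p) a)) = a"
      by (auto simp: C1_def C_def nb_walks_def length_Suc_conv)
    show "\<forall>a'\<in>nb_walks E (Suc s) u v. (\<lambda>(w, p). u # p) (a' ! 1, tl a') = a'"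
      by (auto simp: nb_walks_def length_Suc_conv)
    show "(\<lambda>(w, p). u # p) ` C1 \<subseteq> nb_walks E (Suc s) u v"
      by (auto simp: C1_def C_def nb_walks_def in_neighbours length_Suc_conv)
    show "(\<lambda>p. (p ! 1, tl p)) ` nb_walks E (Suc s) u v \<subseteq> C1"
      by (auto simp: C1_def C_def nb_walks_def in_neighbours length_Suc_conv
          dest: nonbacktracking_Cons)
  qed
  also have "card C2 = (if s = 0 then 0 else
      (\<Sum>p\<in>nb_walks E (s - 1) u v. card {w \<in> neighbours E u. s = 1 \<or> p ! 1 \<noteq> w}))"
  proof (cases "s = 0")
    case True
    have "C2 = {}"
      by (auto simp: C2_def C_def True nb_walks_def length_Suc_conv)
    then show ?thesis using True by simp
  next
    case False
    define D where "D = (SIGMA p:nb_walks E (s - 1) u v. {w \<in> neighbours E u. s = 1 \<or> p ! 1 \<noteq> w})"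
    have "card C2 = card D"
    proof (rule bij_betw_same_card, rule bij_betw_byWitness[where f' = "\<lambda>(p, w). (w, w # p)"])
      show "\<forall>a\<in>C2. (\<lambda>(p, w). (w, w # p)) ((\<lambda>(w, p). (tl p, w)) a) = a"
        by (auto simp: C2_def C_def elim: nb_walks_step_cases)
      show "\<forall>a'\<in>D. (\<lambda>(w, p). (tl p, w)) ((\<lambda>(p, w). (w, w # p)) a') = a'"
        by auto
      show "(\<lambda>(w, p). (tl p, w)) ` C2 \<subseteq> D"
      proof clarify
        fix w p assume "(w, p) \<in> C2"
        then have "p \<in> nb_walks E s w v" "\<not> nonbacktracking (u # p)" "w \<in> neighbours E u"
          by (auto simp: C2_def C_def)
        then obtain q where q: "p = w # u # q" "u # q \<in> nb_walks E (s - 1) u v"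
          "case q of [] \<Rightarrow> True | x # _ \<Rightarrow> x \<noteq> w"
          by (auto elim: nb_walks_step_cases)
        have "s = 1 \<or> (u # q) ! 1 \<noteq> w"
          using q False by (cases q) (auto simp: nb_walks_def)
        then show "(tl p, w) \<in> D"
          using q \<open>w \<in> neighbours E u\<close> by (auto simp: D_def)
      qed
      show "(\<lambda>(p, w). (w, w # p)) ` D \<subseteq> C2"
      proof clarify
        fix p w assume pw: "(p, w) \<in> D"
        then have "length p = Suc (s - 1)" "hd p = u" by (auto simp: D_def nb_walks_def)
        then obtain q where p: "p = u # q" by (cases p) auto
        have len: "length q = s - 1" using pw by (auto simp: D_def p nb_walks_def)
        have "nonbacktracking (w # u # q)"
          using pw len by (cases q) (auto simp: D_def p nb_walks_def)
        then show "(w, w # p) \<in> C2"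
          using pw False len by (auto simp: C2_def C_def D_def p nb_walks_def in_neighbours insert_commute)
      qed
    qed
    also have "\<dots> = (\<Sum>p\<in>nb_walks E (s - 1) u v. card {w \<in> neighbours E u. s = 1 \<or> p ! 1 \<noteq> w})"
      unfolding D_def using finite_nb_walks[OF finU] finN by simp
    finally show ?thesis using False by simp
  qed
  finally show ?thesis .
qed

definition nb_count :: "'a set set \<Rightarrow> nat \<Rightarrow> 'a \<Rightarrow> 'a \<Rightarrow> real" where
  "nb_count E s u v = real (card (nb_walks E s u v))"

lemma nb_count_0: "nb_count E 0 u v = of_bool (u = v)"
  by (simp add: nb_count_def nb_walks_0)

lemma nb_count_1: "nb_count E (Suc 0) u v = of_bool (v \<in> neighbours E u)"
  by (simp add: nb_count_def nb_walks_1)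

lemma nb_count_step_1:
  assumes "finite (\<Union>E)"
  shows "(\<Sum>w\<in>neighbours E u. nb_count E 1 w v)
          = nb_count E 2 u v + real (card (neighbours E u)) * nb_count E 0 u v"
proof -
  have "(\<Sum>w\<in>neighbours E u. card (nb_walks E 1 w v)) =
      card (nb_walks E 2 u v) + card (neighbours E u) * card (nb_walks E 0 u v)"
    using nb_walks_step[OF assms, where u = u and s = 1 and v = v] by (simp add: numeral_2_eq_2)
  then show ?thesis
    unfolding nb_count_def by (simp flip: of_nat_sum of_nat_mult of_nat_add)
qed

lemma nb_count_step:
  assumes finU: "finite (\<Union>E)" and "2 \<le> s"
  shows "(\<Sum>w\<in>neighbours E u. nb_count E s w v)
          = nb_count E (s + 1) u v + (real (card (neighbours E u)) - 1) * nb_count E (s - 1) u v"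
proof -
  have finN: "finite (neighbours E u)"
    by (rule finite_subset[OF _ finU]) (auto simp: in_neighbours)
  have c: "real (card {w \<in> neighbours E u. s = 1 \<or> p ! 1 \<noteq> w}) = real (card (neighbours E u)) - 1"
    if p: "p \<in> nb_walks E (s - 1) u v" for p
  proof -
    obtain x q where "p = u # x # q"
      using p assms(2) by (cases p; cases "tl p") (auto simp: nb_walks_def)
    then have x: "p ! 1 \<in> neighbours E u" using p by (auto simp: nb_walks_def in_neighbours)
    have "{w \<in> neighbours E u. s = 1 \<or> p ! 1 \<noteq> w} = neighbours E u - {p ! 1}"
      using assms(2) by auto
    moreover have "card (neighbours E u) > 0" using x finN by (auto simp: card_gt_0_iff)
    ultimately show ?thesis using x finN by (simp add: of_nat_diff)
  qed
  have "(\<Sum>w\<in>neighbours E u. nb_count E s w v) = nb_count E (s + 1) u v +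
      (\<Sum>p\<in>nb_walks E (s - 1) u v. real (card {w \<in> neighbours E u. s = 1 \<or> p ! 1 \<noteq> w}))"
    using nb_walks_step[OF finU, where u = u and s = s and v = v] assms(2) unfolding nb_count_def
    by (simp flip: of_nat_sum of_nat_add)
  also have "(\<Sum>p\<in>nb_walks E (s - 1) u v. real (card {w \<in> neighbours E u. s = 1 \<or> p ! 1 \<noteq> w}))
      = (\<Sum>p\<in>nb_walks E (s - 1) u v. real (card (neighbours E u)) - 1)"
    by (rule sum.cong) (use c in auto)
  finally show ?thesis by (simp add: nb_count_def algebra_simps)
qed

lemma biregular_finite_Union:
  assumes "E \<in> biregular_graphs m n dL dR"
  shows "finite (\<Union>E)"
  by (rule finite_subset[of _ "{..<m+n}"]) (use biregular_subset_Pow[OF assms] in auto)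

text \<open>The one-step recurrence is applied at the left vertices \<open>w\<close> and then at
  \<open>u\<close>. Short lengths are exceptional since the walk of length 0 has no first edge:
  every neighbour of \<open>u\<close> gives an immediate return, which explains \<open>dR\<close>
  where the later coefficient has \<open>dR - 1\<close>.\<close>

lemma nb_count_two_steps:
  assumes E: "E \<in> biregular_graphs m n dL dR" and u: "m \<le> u" "u < m + n"
  defines "S \<equiv> \<lambda>s v. \<Sum>w\<in>neighbours E u. \<Sum>x\<in>neighbours E w. nb_count E s x v"
  shows "S 0 v = nb_count E 2 u v + real dR * nb_count E 0 u v" (is ?base)
    and "S 2 v = nb_count E 4 u v + (real dR + real dL - 2) * nb_count E 2 u v
          + real dR * (real dL - 1) * nb_count E 0 u v" (is ?first)
    and "3 \<le> s \<Longrightarrow> S s v = nb_count E (s + 2) u v + (real dR + real dL - 2) * nb_count E s u v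
          + (real dR - 1) * (real dL - 1) * nb_count E (s - 2) u v" (is "_ \<Longrightarrow> ?later")
proof -
  note fin = biregular_finite_Union[OF E]
  note finN = biregular_neighbours_finite[OF E]
  have cu: "card (neighbours E u) = dR" by (rule biregular_neighbours_right(2)[OF E u])
  have cw: "card (neighbours E w) = dL" if "w \<in> neighbours E u" for w
    using biregular_neighbours_left(2)[OF E] biregular_neighbours_right(1)[OF E u] that by auto
  have "S 0 v = (\<Sum>w\<in>neighbours E u. nb_count E 1 w v)"
    unfolding S_def
    by (rule sum.cong) (auto simp: nb_count_0 nb_count_1 of_bool_def sum.delta finN)
  also have "\<dots> = nb_count E 2 u v + real dR * nb_count E 0 u v"
    using nb_count_step_1[OF fin, where u = u and v = v] by (simp add: cu)
  finally show ?base .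
  have two: "S s v = (\<Sum>w\<in>neighbours E u. nb_count E (s + 1) w v)
        + (real dL - 1) * (\<Sum>w\<in>neighbours E u. nb_count E (s - 1) w v)" if "2 \<le> s" for s
  proof -
    have "S s v = (\<Sum>w\<in>neighbours E u. nb_count E (s + 1) w v + (real dL - 1) * nb_count E (s - 1) w v)"
      unfolding S_def by (rule sum.cong) (auto simp: nb_count_step[OF fin that] cw)
    then show ?thesis by (simp add: sum.distrib sum_distrib_left)
  qed
  show ?first
    using two[of 2] nb_count_step[OF fin, where s = 3 and u = u and v = v] nb_count_step_1[OF fin, where u = u and v = v]
    by (simp add: cu algebra_simps numeral_eq_Suc)
  assume s: "3 \<le> s"
  have h1: "(\<Sum>w\<in>neighbours E u. nb_count E (s + 1) w v)
      = nb_count E (s + 2) u v + (real dR - 1) * nb_count E s u v"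
    using nb_count_step[OF fin, where s = "s + 1" and u = u and v = v] s by (simp add: cu)
  have h2: "(\<Sum>w\<in>neighbours E u. nb_count E (s - 1) w v)
      = nb_count E s u v + (real dR - 1) * nb_count E (s - 2) u v"
    using nb_count_step[OF fin, where s = "s - 1" and u = u and v = v] s
    by (simp add: cu numeral_2_eq_2)
  have "2 \<le> s" using s by simp
  from two[OF this] show ?later
    unfolding h1 h2 by (simp add: algebra_simps)
qed

section \<open>The number of closed non-backtracking walks\<close>

text \<open>The condition is not cyclic: the last step may reverse the first. Such walks also repeat
  a vertex and thus contain a cycle, and they do occur in the trace. The set \<open>V\<close> makes
  the set of walks finite even for \<open>s = 0\<close>.\<close>

definition closed_nb_walks :: "'a set set \<Rightarrow> 'a set \<Rightarrow> nat \<Rightarrow> 'a list set" where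
  "closed_nb_walks E V s = {p. length p = Suc s \<and> set p \<subseteq> V \<and> hd p = last p \<and> edges p \<subseteq> E \<and> nonbacktracking p}"

lemma finite_closed_nb_walks: "finite V \<Longrightarrow> finite (closed_nb_walks E V s)"
  by (rule finite_subset[of _ "{p. set p \<subseteq> V \<and> length p = Suc s}"])
    (auto simp: closed_nb_walks_def intro: finite_lists_length_eq)

text \<open>The square counts pairs of walks. A pair whose trace has edge set \<open>F\<close> lies
  in a proportion of at most \<open>x ^ card F\<close> of the graphs, and since
  \<open>x \<le> 1\<close> and edges are at least as many as vertices, this is at most
  \<open>x ^ card\<close> of the vertex set. What remains is a sum over all lists of
  vertices.\<close>

lemma sum_square_closed_nb_walks_le:
  assumes nz: "0 < dR" "0 < n" "0 < s" and m: "m * dL = n * dR"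
    and large: "2 * (2 * s + 2 * dL * dR) \<le> n * dR" "2 * dL \<le> n"
  shows "(\<Sum>E\<in>biregular_graphs m n dL dR. (real (card (closed_nb_walks E {..<m+n} s)))\<^sup>2)
     \<le> real (2 * Suc s + 2 * (dL + dR)) ^ (2 * Suc s) * real (card (biregular_graphs m n dL dR))"
proof -
  define B where "B = biregular_graphs m n dL dR"
  define K where "K = {{u, v} | u v. u < m \<and> m \<le> v \<and> v < m + n}"
  \<comment> \<open>Walks in the complete bipartite graph: an index set independent of the random
    graph, so that the sums can be exchanged.\<close>
  define W where "W = closed_nb_walks K {..<m+n} s"
  define x where "x = 2 * real dL / real n"
  have x: "0 \<le> x" "x \<le> 1" using nz large(2) by (auto simp: x_def)
  have finB: "finite B" by (simp add: B_def finite_biregular_graphs)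
  have finW: "finite W" by (simp add: W_def finite_closed_nb_walks)
  have noloop: "{z} \<notin> K" for z by (auto simp: K_def doubleton_eq_iff)
  have walks: "closed_nb_walks E {..<m+n} s = {p \<in> W. edges p \<subseteq> E}" if "E \<in> B" for E
  proof -
    have "E \<subseteq> K"
    proof
      fix e assume "e \<in> E"
      with that obtain u v where "e = {u, v}" "u < m" "m \<le> v" "v < m + n"
        unfolding B_def by (rule biregular_edge_cases)
      then show "e \<in> K" by (auto simp: K_def)
    qed
    then show ?thesis by (auto simp: W_def closed_nb_walks_def)
  qed
  have square: "(real (card (closed_nb_walks E {..<m+n} s)))\<^sup>2
      = (\<Sum>z\<in>W \<times> W. of_bool (edges (fst z) \<union> edges (snd z) \<subseteq> E))" if "E \<in> B" for E
  proof -
    have "{z \<in> W \<times> W. edges (fst z) \<union> edges (snd z) \<subseteq> E} = {p \<in> W. edges p \<subseteq> E} \<times> {p \<in> W. edges p \<subseteq> E}"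
      by auto
    then show ?thesis
      using finW by (simp add: walks[OF that] power2_eq_square card_cartesian_product of_bool_def sum.If_cases Int_def)
  qed
  have "(\<Sum>E\<in>B. (real (card (closed_nb_walks E {..<m+n} s)))\<^sup>2)
      = (\<Sum>E\<in>B. \<Sum>z\<in>W \<times> W. of_bool (edges (fst z) \<union> edges (snd z) \<subseteq> E))"
    by (rule sum.cong) (auto simp: square)
  also have "\<dots> = (\<Sum>z\<in>W \<times> W. \<Sum>E\<in>B. of_bool (edges (fst z) \<union> edges (snd z) \<subseteq> E))"
    by (rule sum.swap)
  also have "\<dots> \<le> (\<Sum>z\<in>W \<times> W. x ^ card (set (fst z @ snd z)) * real (card B))"
  proof (rule sum_mono)
    fix z assume "z \<in> W \<times> W"
    then obtain p q where z: "z = (p, q)" "p \<in> W" "q \<in> W" by auto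
    define F where "F = edges p \<union> edges q"
    \<comment> \<open>With at least one step, equal first and last vertices are a
      repetition.\<close>
    have nd: "\<not> distinct l" if "l \<in> W" for l
      using that nz(3) by (cases l; cases "tl l") (auto simp: W_def closed_nb_walks_def split: if_splits)
    have "card F \<le> card (edges p) + card (edges q)" unfolding F_def by (rule card_Un_le)
    also have "\<dots> \<le> (length p - 1) + (length q - 1)" by (intro add_mono card_edges_le)
    also have "\<dots> = 2 * s" using z by (simp add: W_def closed_nb_walks_def)
    finally have cF: "card F \<le> 2 * s" .
    have FK: "F \<subseteq> K" using z by (auto simp: F_def W_def closed_nb_walks_def)
    have "edge_rich (set p \<union> set q) F"
      unfolding F_def using z nd noloop
      by (intro edge_rich_union) (auto simp: W_def closed_nb_walks_def)
    then have "card (set p \<union> set q) \<le> card F" by (simp add: edge_rich_def)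
    then have "x ^ card F \<le> x ^ card (set (fst z @ snd z))"
      using x by (intro power_decreasing) (auto simp: z)
    have "(\<Sum>E\<in>B. of_bool (edges (fst z) \<union> edges (snd z) \<subseteq> E)) = real (card {E \<in> B. F \<subseteq> E})"
      using finB by (simp add: z F_def of_bool_def sum.If_cases Int_def)
    also have "\<dots> \<le> x ^ card F * real (card B)"
      unfolding B_def x_def
      by (rule card_supergraphs_le[OF nz(1,2) _ cF large(1)]) (use FK in \<open>simp add: K_def\<close>)
    also have "\<dots> \<le> x ^ card (set (fst z @ snd z)) * real (card B)"
      by (rule mult_right_mono) (fact, simp)
    finally show "(\<Sum>E\<in>B. of_bool (edges (fst z) \<union> edges (snd z) \<subseteq> E))
        \<le> x ^ card (set (fst z @ snd z)) * real (card B)" .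
  qed
  also have "\<dots> = (\<Sum>z\<in>W \<times> W. x ^ card (set (fst z @ snd z))) * real (card B)"
    by (simp add: sum_distrib_right)
  also have "\<dots> \<le> (\<Sum>l | set l \<subseteq> {..<m+n} \<and> length l = 2 * Suc s. x ^ card (set l)) * real (card B)"
  proof (rule mult_right_mono)
    \<comment> \<open>All walks have length \<open>Suc s\<close>, so the concatenation can be split
      again.\<close>
    have inj: "inj_on (\<lambda>z. fst z @ snd z) (W \<times> W)"
      by (auto simp: inj_on_def W_def closed_nb_walks_def)
    have "(\<Sum>z\<in>W \<times> W. x ^ card (set (fst z @ snd z))) = (\<Sum>l\<in>(\<lambda>z. fst z @ snd z) ` (W \<times> W). x ^ card (set l))"
      using sum.reindex[OF inj, of "\<lambda>l. x ^ card (set l)"] by simp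
    also have "\<dots> \<le> (\<Sum>l | set l \<subseteq> {..<m+n} \<and> length l = 2 * Suc s. x ^ card (set l))"
      by (rule sum_mono2)
        (use x in \<open>auto simp: W_def closed_nb_walks_def intro: finite_lists_length_eq\<close>)
    finally show "(\<Sum>z\<in>W \<times> W. x ^ card (set (fst z @ snd z)))
        \<le> (\<Sum>l | set l \<subseteq> {..<m+n} \<and> length l = 2 * Suc s. x ^ card (set l))" .
  qed simp
  also have "\<dots> \<le> (real (2 * Suc s) + real (card {..<m+n}) * x) ^ (2 * Suc s) * real (card B)"
    by (intro mult_right_mono sum_power_card_set_le) (use x in auto)
  \<comment> \<open>Here \<open>n\<close> disappears: \<open>m * dL / n = dR\<close> by the double
    count of the arcs.\<close>
  also have "real (card {..<m+n}) * x = 2 * (real (m * dL) / real n + real dL)"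
    using nz by (simp add: x_def field_simps)
  also have "\<dots> = real (2 * (dL + dR))"
    unfolding m using nz by simp
  finally show ?thesis by (simp only: B_def of_nat_add)
qed

section \<open>From the second moment to almost sure bounds\<close>

lemma random_biregular_graph_in:
  assumes "random_biregular_graph M m n dL dR G" "\<omega> \<in> space M"
  shows "G \<omega> \<in> biregular_graphs m n dL dR"
  using assms by (auto simp: random_biregular_graph_def dest: measurable_space)

lemma random_biregular_graph_measure:
  assumes "random_biregular_graph M m n dL dR G"
  shows "{\<omega> \<in> space M. P (G \<omega>)} \<in> sets M"
    and "measure M {\<omega> \<in> space M. P (G \<omega>)} =
      real (card {E \<in> biregular_graphs m n dL dR. P E}) / real (card (biregular_graphs m n dL dR))"
proof -
  define B where "B = biregular_graphs m n dL dR"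
  have G: "G \<in> measurable M (count_space B)"
    and d: "distr M (count_space B) G = uniform_count_measure B"
    using assms by (auto simp: random_biregular_graph_def B_def)
  have eq: "{\<omega> \<in> space M. P (G \<omega>)} = G -` {E \<in> B. P E} \<inter> space M"
    using random_biregular_graph_in[OF assms] by (auto simp: B_def)
  show "{\<omega> \<in> space M. P (G \<omega>)} \<in> sets M"
    unfolding eq using G by (rule measurable_sets) auto
  have "measure M {\<omega> \<in> space M. P (G \<omega>)} = measure (distr M (count_space B) G) {E \<in> B. P E}"
    unfolding eq using G by (subst measure_distr) auto
  also have "\<dots> = real (card {E \<in> B. P E}) / real (card B)"
    unfolding d by (rule measure_uniform_count_measure) (auto simp: B_def finite_biregular_graphs)
  finally show "measure M {\<omega> \<in> space M. P (G \<omega>)} =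
      real (card {E \<in> biregular_graphs m n dL dR. P E}) / real (card (biregular_graphs m n dL dR))"
    by (simp add: B_def)
qed

text \<open>Chebyshev's inequality in counting form, for the uniform distribution on a finite
  set.\<close>

lemma prob_many_closed_nb_walks_le:
  assumes G: "random_biregular_graph M m n dL dR G" and M: "space M \<noteq> {}"
    and nz: "0 < dR" "0 < n" "0 < s" "0 < t"
    and large: "2 * (2 * s + 2 * dL * dR) \<le> n * dR" "2 * dL \<le> n"
  shows "measure M {\<omega> \<in> space M. t \<le> real (card (closed_nb_walks (G \<omega>) {..<m+n} s))}
    \<le> real (2 * Suc s + 2 * (dL + dR)) ^ (2 * Suc s) / t\<^sup>2"
proof -
  define B where "B = biregular_graphs m n dL dR"
  define f where "f E = real (card (closed_nb_walks E {..<m+n} s))" for E :: "nat set set"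
  define R where "R = real (2 * Suc s + 2 * (dL + dR)) ^ (2 * Suc s)"
  have finB: "finite B" by (simp add: B_def finite_biregular_graphs)
  \<comment> \<open>A sample point provides one biregular graph, and its arcs give
    \<open>m * dL = n * dR\<close>.\<close>
  obtain \<omega> where "\<omega> \<in> space M" using M by auto
  then have E: "G \<omega> \<in> B" using random_biregular_graph_in[OF G] by (simp add: B_def)
  then have m: "m * dL = n * dR"
    using card_arcs_left card_arcs_right unfolding B_def by metis
  have cB: "0 < card B" using E finB by (auto simp: card_gt_0_iff)
  have "real (card {E \<in> B. t \<le> f E}) * t\<^sup>2 = (\<Sum>E | E \<in> B \<and> t \<le> f E. t\<^sup>2)" by simp
  also have "\<dots> \<le> (\<Sum>E | E \<in> B \<and> t \<le> f E. (f E)\<^sup>2)"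
    using nz by (intro sum_mono power_mono) auto
  also have "\<dots> \<le> (\<Sum>E\<in>B. (f E)\<^sup>2)"
    using finB by (intro sum_mono2) auto
  also have "\<dots> \<le> R * real (card B)"
    unfolding B_def f_def R_def
    by (rule sum_square_closed_nb_walks_le[OF nz(1-3) m large])
  finally have "real (card {E \<in> B. t \<le> f E}) / real (card B) \<le> R / t\<^sup>2"
    using nz cB by (simp add: field_simps)
  moreover have "measure M {\<omega> \<in> space M. t \<le> f (G \<omega>)} = real (card {E \<in> B. t \<le> f E}) / real (card B)"
    unfolding B_def by (rule random_biregular_graph_measure(2)[OF G])
  ultimately show ?thesis unfolding f_def R_def by simp
qed

text \<open>The growth condition on \<open>dR\<close> is used only here, once for each
  \<open>s\<close>. It yields both the size conditions of the switching argument and the bound on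
  the second moment.\<close>

lemma eventually_degrees_small:
  fixes n dL dR :: "nat \<Rightarrow> nat"
  assumes n: "strict_mono n" and le: "\<And>k. dL k \<le> dR k"
    and dR: "filterlim dR at_top sequentially"
    and small: "\<forall>\<epsilon>::real. \<epsilon> > 0 \<longrightarrow> (\<lambda>k. real (dR k)) \<in> o(\<lambda>k. real (n k) powr \<epsilon>)"
  shows "\<forall>\<^sub>F k in sequentially. 0 < dR k \<and> 0 < n k \<and> k \<le> n k \<and>
    2 * (2 * s + 2 * dL k * dR k) \<le> n k * dR k \<and> 2 * dL k \<le> n k \<and>
    real (2 * Suc s + 2 * (dL k + dR k)) ^ (2 * Suc s) \<le> real (n k) powr (1/4)"
proof -
  define D where "D = 2 * Suc s"
  \<comment> \<open>\<open>D\<close> is the exponent in the second moment bound, so that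
    \<open>(N powr \<epsilon>) ^ D = N powr (1/4)\<close>. The factor \<open>1 / (D + 4)\<close>
    below absorbs the base, which is at most \<open>D * dR + 4 * dR\<close>.\<close>
  define \<epsilon> where "\<epsilon> = 1 / (4 * real D)"
  have eps: "0 < \<epsilon>" "\<epsilon> \<le> 1/2" by (auto simp: \<epsilon>_def D_def field_simps)
  have "\<forall>\<^sub>F k in sequentially. norm (real (dR k)) \<le> (1 / real (D + 4)) * norm (real (n k) powr \<epsilon>)"
    by (rule landau_o.smallD[OF small[rule_format, OF eps(1)]]) (simp add: D_def)
  moreover have "\<forall>\<^sub>F k in sequentially. 1 \<le> dR k"
    using dR by (simp add: filterlim_at_top)
  moreover have "\<forall>\<^sub>F k in sequentially. (4::nat) \<le> k" by (rule eventually_ge_at_top)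
  ultimately show ?thesis
  proof eventually_elim
    case (elim k)
    \<comment> \<open>Comparing \<open>n k\<close> with \<open>k\<close> makes the later bounds
      summable in the index \<open>k\<close>.\<close>
    have nk: "k \<le> n k" using n by (rule seq_suble)
    then have n4: "4 \<le> n k" using elim by simp
    define N where "N = real (n k)"
    have N: "4 \<le> N" using n4 by (simp add: N_def)
    have a: "real (D + 4) * real (dR k) \<le> N powr \<epsilon>"
      using elim(1) by (simp add: N_def field_simps)
    have "real (2 * Suc s + 2 * (dL k + dR k)) \<le> real (D + 4) * real (dR k)"
    proof -
      have "D * 1 \<le> D * dR k" using elim(2) by (intro mult_le_mono2)
      then have "2 * Suc s + 2 * (dL k + dR k) \<le> (D + 4) * dR k"
        using le[of k] by (simp add: D_def algebra_simps)
      then show ?thesis by (metis of_nat_le_iff of_nat_mult)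
    qed
    then have b: "real (2 * Suc s + 2 * (dL k + dR k)) \<le> N powr \<epsilon>" using a by linarith
    then have "real (2 * Suc s + 2 * (dL k + dR k)) ^ D \<le> (N powr \<epsilon>) ^ D"
      by (intro power_mono) auto
    also have "\<dots> = N powr (1/4)"
    proof -
      have "(N powr \<epsilon>) ^ D = N powr (\<epsilon> * real D)"
        using N by (simp add: powr_powr flip: powr_realpow)
      also have "\<epsilon> * real D = 1/4" by (simp add: \<epsilon>_def D_def)
      finally show ?thesis .
    qed
    finally have c: "real (2 * Suc s + 2 * (dL k + dR k)) ^ (2 * Suc s) \<le> N powr (1/4)" by (simp add: D_def)
    have "N powr \<epsilon> \<le> N powr (1/2)" using N eps by (intro powr_mono) auto
    also have "\<dots> = sqrt N" using N by (simp add: powr_half_sqrt)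
    also have "\<dots> \<le> N / 2"
      using N by (intro real_le_lsqrt) (auto simp: power2_eq_square)
    finally have "real (2 * Suc s + 2 * (dL k + dR k)) \<le> N / 2" using b by linarith
    then have "real (2 * (2 * Suc s + 2 * (dL k + dR k))) \<le> real (n k)" by (simp add: N_def)
    then have d: "2 * (2 * Suc s + 2 * (dL k + dR k)) \<le> n k" by linarith
    have "4 * s + 4 * dL k \<le> 2 * (2 * Suc s + 2 * (dL k + dR k))" by simp
    then have "4 * s + 4 * dL k \<le> n k" using d by (rule order_trans)
    then have "(4 * s + 4 * dL k) * dR k \<le> n k * dR k" by (rule mult_le_mono1)
    moreover have "4 * s * 1 \<le> 4 * s * dR k" using elim(2) by (intro mult_le_mono2)
    moreover have "2 * (2 * s + 2 * dL k * dR k) = 4 * s * 1 + 4 * dL k * dR k"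
      "(4 * s + 4 * dL k) * dR k = 4 * s * dR k + 4 * dL k * dR k"
      by (simp_all add: algebra_simps)
    ultimately have "2 * (2 * s + 2 * dL k * dR k) \<le> n k * dR k" by linarith
    then show ?case using nk n4 elim(2) d c by (auto simp: N_def)
  qed
qed

lemma AE_few_closed_nb_walks:
  fixes m n dL dR :: "nat \<Rightarrow> nat"
  assumes M: "prob_space M" and n: "strict_mono n" and le: "\<And>k. dL k \<le> dR k"
    and G: "\<And>k. random_biregular_graph M (m k) (n k) (dL k) (dR k) (G k)"
    and dR: "filterlim dR at_top sequentially"
    and small: "\<forall>\<epsilon>::real. \<epsilon> > 0 \<longrightarrow> (\<lambda>k. real (dR k)) \<in> o(\<lambda>k. real (n k) powr \<epsilon>)"
    and s: "0 < s"
  shows "AE \<omega> in M. \<forall>\<^sub>F k in sequentially.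
    real (card (closed_nb_walks (G k \<omega>) {..<m k + n k} s)) < real (n k) powr (7/8)"
proof -
  interpret prob_space M by (rule M)
  \<comment> \<open>The exponent \<open>7/8\<close> is below 1, so these walks vanish after division
    by \<open>n\<close>, and \<open>2 * 7/8 - 1/4 = 3/2\<close> exceeds 1, so the probabilities are
    summable.\<close>
  define A where "A k = {\<omega> \<in> space M. real (n k) powr (7/8)
      \<le> real (card (closed_nb_walks (G k \<omega>) {..<m k + n k} s))}" for k
  have "AE \<omega> in M. \<forall>\<^sub>F k in sequentially. \<omega> \<in> space M - A k"
  proof (rule borel_cantelli_AE1)
    show "A k \<in> sets M" for k
      unfolding A_def by (rule random_biregular_graph_measure(1)[OF G])
    show "emeasure M (A k) < \<infinity>" for k
      by (simp add: emeasure_eq_measure)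
    show "summable (\<lambda>k. measure M (A k))"
    proof (rule summable_comparison_test_ev)
      show "summable (\<lambda>k. real k powr (-3/2))" by (subst summable_real_powr_iff) simp
      show "\<forall>\<^sub>F k in sequentially. norm (measure M (A k)) \<le> real k powr (-3/2)"
        using eventually_degrees_small[OF n le dR small, of s] eventually_gt_at_top[of 0]
      proof eventually_elim
        case (elim k)
        define N where "N = real (n k)"
        have N: "0 < N" using elim by (simp add: N_def)
        have "measure M (A k) \<le> real (2 * Suc s + 2 * (dL k + dR k)) ^ (2 * Suc s) / (N powr (7/8))\<^sup>2"
          unfolding A_def N_def
          by (rule prob_many_closed_nb_walks_le[OF G]) (use elim s not_empty in auto)
        also have "\<dots> \<le> N powr (1/4) / (N powr (7/8))\<^sup>2"
          using elim by (intro divide_right_mono) (auto simp: N_def)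
        also have "\<dots> = N powr (-3/2)"
        proof -
          have "(N powr (7/8))\<^sup>2 = N powr (7/4)"
            by (simp add: power2_eq_square flip: powr_add)
          then show ?thesis by (simp flip: powr_diff)
        qed
        also have "\<dots> \<le> real k powr (-3/2)"
          using elim by (intro powr_mono2') (auto simp: N_def)
        finally show ?case by simp
      qed
    qed
  qed
  then show ?thesis
    by eventually_elim (auto simp: A_def not_le elim: eventually_mono)
qed

section \<open>Eigenvalues of symmetric matrices\<close>

text \<open>The quadratic form \<open>S\<close> of \<open>a\<close> at \<open>v\<close> equals its
  own conjugate, and it is \<open>k\<close> times the positive number \<open>N\<close>.\<close>

lemma symmetric_eigenvalue_real:
  fixes a :: "nat \<Rightarrow> nat \<Rightarrow> real" and v :: "nat \<Rightarrow> complex"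
  assumes sym: "\<And>i j. i < n \<Longrightarrow> j < n \<Longrightarrow> a i j = a j i"
    and ev: "\<And>i. i < n \<Longrightarrow> (\<Sum>j<n. of_real (a i j) * v j) = k * v i"
    and nz: "i < n" "v i \<noteq> 0"
  shows "k \<in> \<real>"
proof -
  define S where "S = (\<Sum>i<n. \<Sum>j<n. of_real (a i j) * v j * cnj (v i))"
  define N where "N = (\<Sum>i<n. (cmod (v i))\<^sup>2)"
  have "S = (\<Sum>i<n. (\<Sum>j<n. of_real (a i j) * v j) * cnj (v i))"
    by (simp add: S_def sum_distrib_right)
  also have "\<dots> = (\<Sum>i<n. k * v i * cnj (v i))"
    by (rule sum.cong) (auto simp: ev)
  also have "\<dots> = k * of_real N"
    by (simp add: N_def sum_distrib_left mult.assoc flip: complex_norm_square)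
  finally have S: "S = k * of_real N" .
  have "cnj S = (\<Sum>i<n. \<Sum>j<n. of_real (a i j) * cnj (v j) * v i)"
    by (simp add: S_def)
  also have "\<dots> = (\<Sum>j<n. \<Sum>i<n. of_real (a i j) * cnj (v j) * v i)"
    by (rule sum.swap)
  also have "\<dots> = S"
    unfolding S_def using sym by (intro sum.cong) auto
  finally have "S \<in> \<real>" by (simp add: Reals_cnj_iff)
  moreover have "N > 0"
    unfolding N_def by (rule sum_pos2[of _ i]) (use nz in auto)
  ultimately have "S / of_real N \<in> \<real>" by simp
  then show ?thesis using S \<open>N > 0\<close> by simp
qed

text \<open>The characteristic polynomial splits over the complex numbers, its roots are real, and
  the factorisation descends because embedding real coefficients is injective.\<close>

lemma symmetric_char_poly_splits:
  fixes A :: "real mat"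
  assumes A: "A \<in> carrier_mat n n" and sym: "transpose_mat A = A"
  obtains es where "char_poly A = (\<Prod>e\<leftarrow>es. [:- e, 1:])" "length es = n"
proof -
  define C :: "complex mat" where "C = map_mat of_real A"
  have C: "C \<in> carrier_mat n n" using A by (simp add: C_def)
  obtain as where as: "char_poly C = (\<Prod>a\<leftarrow>as. [:- a, 1:])" "length as = n"
    using char_poly_factorized[OF C] by blast
  have real: "a \<in> \<real>" if "a \<in> set as" for a
  proof -
    have "poly (char_poly C) a = 0" unfolding as(1) using that by (rule linear_poly_root)
    then have "eigenvalue C a" using eigenvalue_root_char_poly[OF C] by simp
    then obtain v where v: "v \<in> carrier_vec n" "v \<noteq> 0\<^sub>v n" "C *\<^sub>v v = a \<cdot>\<^sub>v v"
      using C by (auto simp: eigenvalue_def eigenvector_def)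
    have "\<exists>i<n. v $ i \<noteq> 0"
    proof (rule ccontr)
      assume "\<not> ?thesis"
      then have "v = 0\<^sub>v n" using v(1) by (intro eq_vecI) auto
      with v(2) show False by simp
    qed
    then obtain i where i: "i < n" "v $ i \<noteq> 0" by auto
    show ?thesis
    proof (rule symmetric_eigenvalue_real[OF _ _ i(1), where a = "\<lambda>i j. A $$ (i, j)" and v = "\<lambda>i. v $ i" and k = a])
      show "A $$ (i, j) = A $$ (j, i)" if "i < n" "j < n" for i j
        using that A sym by (metis carrier_matD index_transpose_mat(1))
    next
      show "v $ i \<noteq> 0" by (rule i(2))
    next
      fix j assume j: "j < n"
      have "(C *\<^sub>v v) $ j = (\<Sum>l<n. of_real (A $$ (j, l)) * v $ l)"
        using j A v(1) by (simp add: C_def scalar_prod_def atLeast0LessThan)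
      then show "(\<Sum>l<n. of_real (A $$ (j, l)) * v $ l) = a * v $ j"
        using v j by simp
    qed
  qed
  interpret of_real_poly: map_poly_comm_ring_hom "of_real :: real \<Rightarrow> complex" ..
  define es where "es = map Re as"
  have hom: "map_poly of_real (\<Prod>e\<leftarrow>xs. [:- e, 1:]) = (\<Prod>e\<leftarrow>xs. [:- complex_of_real e, 1:])" for xs
    by (induction xs) (simp_all add: of_real_poly.hom_mult map_poly_pCons del: mult_pCons_left)
  have "(\<Prod>a\<leftarrow>as. [:- a, 1:]) = (\<Prod>e\<leftarrow>es. [:- complex_of_real e, 1:])"
  proof -
    have "map (\<lambda>a. [:- a, 1:]) as = map (\<lambda>e. [:- complex_of_real e, 1:]) es"
      using real by (auto simp: es_def)
    then show ?thesis by simp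
  qed
  then have "map_poly of_real (char_poly A) = map_poly complex_of_real (\<Prod>e\<leftarrow>es. [:- e, 1:])"
    using as(1) of_real_hom.char_poly_hom[OF A, where 'a = complex] hom[of es] by (simp add: C_def)
  then have "char_poly A = (\<Prod>e\<leftarrow>es. [:- e, 1:])"
    by (simp add: poly_eq_iff coeff_map_poly)
  with as(2) show ?thesis by (intro that[of es]) (auto simp: es_def)
qed

lemma proots_prod_linear: "proots (\<Prod>e\<leftarrow>es. [:- e, 1:]) = mset (es :: 'a :: idom list)"
proof (induction es)
  case (Cons e es)
  have "(\<Prod>e\<leftarrow>es. [:- e, 1:]) \<noteq> 0" by (auto simp: prod_list_zero_iff)
  then show ?case using Cons by (simp add: proots_mult del: mult_pCons_left)
qed simp

section \<open>Traces of polynomials in a symmetric matrix\<close>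

text \<open>The monic polynomials with recurrence
  \<open>x * q_r = q_(r+1) + \<beta> r * q_r + \<gamma> r * q_(r-1)\<close>, as for orthogonal
  polynomials. They are kept as functions on the reals; their matrix version is characterised by the
  recurrence instead of being evaluated.\<close>

fun three_term :: "(nat \<Rightarrow> real) \<Rightarrow> (nat \<Rightarrow> real) \<Rightarrow> nat \<Rightarrow> real \<Rightarrow> real" where
  "three_term \<beta> \<gamma> 0 x = 1"
| "three_term \<beta> \<gamma> (Suc 0) x = x - \<beta> 0"
| "three_term \<beta> \<gamma> (Suc (Suc r)) x =
     (x - \<beta> (Suc r)) * three_term \<beta> \<gamma> (Suc r) x - \<gamma> (Suc r) * three_term \<beta> \<gamma> r x"

text \<open>A substitute for \<open>W = f(A)\<close> with \<open>A = P * B * Q\<close>: the same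
  change of basis makes \<open>W\<close> triangular, with the values of \<open>f\<close> on the
  diagonal. The entries above the diagonal are left open, since the trace does not see them.\<close>

definition triangularised :: "nat \<Rightarrow> real mat \<Rightarrow> real mat \<Rightarrow> real mat \<Rightarrow> real mat \<Rightarrow> (real \<Rightarrow> real) \<Rightarrow> bool" where
  "triangularised n B P Q W f \<longleftrightarrow> (\<exists>U \<in> carrier_mat n n. upper_triangular U \<and>
     (\<forall>i<n. U $$ (i, i) = f (B $$ (i, i))) \<and> W = P * U * Q)"

text \<open>The diagonal of a product of upper triangular matrices is the product of the diagonals,
  so the recurrence of the matrices becomes that of the functions on the eigenvalues.\<close>

lemma triangularised_step:
  assumes B: "B \<in> carrier_mat n n" "upper_triangular B"
    and PQ: "P \<in> carrier_mat n n" "Q \<in> carrier_mat n n" "Q * P = 1\<^sub>m n"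
    and W: "triangularised n B P Q W f" and W': "triangularised n B P Q W' g"
    and Z: "Z \<in> carrier_mat n n" "(P * B * Q) * W = Z + b \<cdot>\<^sub>m W + c \<cdot>\<^sub>m W'"
  shows "triangularised n B P Q Z (\<lambda>x. (x - b) * f x - c * g x)"
proof -
  obtain U where U: "U \<in> carrier_mat n n" "upper_triangular U"
    "\<And>i. i < n \<Longrightarrow> U $$ (i, i) = f (B $$ (i, i))" "W = P * U * Q"
    using W by (auto simp: triangularised_def)
  obtain U' where U': "U' \<in> carrier_mat n n" "upper_triangular U'"
    "\<And>i. i < n \<Longrightarrow> U' $$ (i, i) = g (B $$ (i, i))" "W' = P * U' * Q"
    using W' by (auto simp: triangularised_def)
  define V where "V = B * U - b \<cdot>\<^sub>m U - c \<cdot>\<^sub>m U'"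
  have V: "V \<in> carrier_mat n n"
    unfolding V_def by (intro minus_carrier_mat smult_carrier_mat U')
  have BU: "(B * U) $$ (i, j) = (\<Sum>l<n. B $$ (i, l) * U $$ (l, j))" if "i < n" "j < n" for i j
    using that B U by (simp add: scalar_prod_def atLeast0LessThan)
  have up: "(B * U) $$ (i, j) = (if j < i then 0 else B $$ (i, i) * U $$ (i, i))"
    if "i < n" "j \<le> i" for i j
  proof -
    \<comment> \<open>For \<open>j \<le> i\<close> a nonzero term needs
      \<open>i \<le> l \<le> j\<close>, hence \<open>l = i = j\<close>.\<close>
    have "B $$ (i, l) * U $$ (l, j) = (if l = i \<and> j = i then B $$ (i, i) * U $$ (i, i) else 0)" if "l < n" for l
    proof -
      have "B $$ (i, l) = 0" if "l < i" using B that \<open>i < n\<close> by (auto simp: upper_triangular_def)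
      moreover have "U $$ (l, j) = 0" if "j < l" using U that \<open>l < n\<close> by (auto simp: upper_triangular_def)
      moreover consider "l < i" | "i \<le> l" "j < l" | "l = i" "j = i"
        using \<open>j \<le> i\<close> by linarith
      ultimately show ?thesis by cases auto
    qed
    then have "(B * U) $$ (i, j) = (\<Sum>l<n. if l = i \<and> j = i then B $$ (i, i) * U $$ (i, i) else 0)"
      using that by (subst BU) (auto intro!: sum.cong)
    also have "\<dots> = (if j < i then 0 else B $$ (i, i) * U $$ (i, i))"
      using that by (cases "j = i") (auto simp: sum.delta)
    finally show ?thesis .
  qed
  have "upper_triangular V"
    unfolding upper_triangular_def
  proof (intro allI impI)
    fix i j assume "i < dim_row V" "j < i"
    then have "i < n" "j < n" "j \<le> i" "j < i" using V by auto
    then show "V $$ (i, j) = 0"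
      using up[of i j] B U U' by (auto simp: V_def upper_triangular_def)
  qed
  moreover have "V $$ (i, i) = (B $$ (i, i) - b) * f (B $$ (i, i)) - c * g (B $$ (i, i))" if "i < n" for i
    using up[of i i] that B U U' by (simp add: V_def algebra_simps)
  moreover have "Z = P * V * Q"
  proof -
    have Wc: "W \<in> carrier_mat n n" "W' \<in> carrier_mat n n" using U U' PQ by auto
    have "(P * B * Q) * W = P * B * (Q * P) * U * Q"
      unfolding U(4) using PQ(1,2) B U(1)
      by (simp add: assoc_mult_mat[of _ n n _ n _ n])
    also have "\<dots> = P * (B * U) * Q"
      using PQ B U(1) by (simp add: assoc_mult_mat[of _ n n _ n _ n])
    finally have 1: "P * (B * U) * Q = Z + b \<cdot>\<^sub>m W + c \<cdot>\<^sub>m W'" using Z(2) by simp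
    have minus: "P * (X - Y) * Q = P * X * Q - P * Y * Q"
      if "X \<in> carrier_mat n n" "Y \<in> carrier_mat n n" for X Y
    proof -
      have "P * (X - Y) = P * X - P * Y"
        by (rule mult_minus_distrib_mat[OF PQ(1) that])
      then show ?thesis
        using minus_mult_distrib_mat[of "P * X" n n "P * Y" Q n] PQ(1,2) that by simp
    qed
    have smult: "P * (k \<cdot>\<^sub>m X) * Q = k \<cdot>\<^sub>m (P * X * Q)" if "X \<in> carrier_mat n n" for k X
    proof -
      have "P * (k \<cdot>\<^sub>m X) = k \<cdot>\<^sub>m (P * X)"
        by (rule mult_smult_distrib[OF PQ(1) that])
      then show ?thesis
        using mult_smult_assoc_mat[of "P * X" n n Q n k] PQ(1,2) that by simp
    qed
    have "B * U \<in> carrier_mat n n" "b \<cdot>\<^sub>m U \<in> carrier_mat n n" "c \<cdot>\<^sub>m U' \<in> carrier_mat n n"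
      "B * U - b \<cdot>\<^sub>m U \<in> carrier_mat n n"
      using B U(1) U'(1) by (auto intro: minus_carrier_mat)
    then have "P * V * Q = P * (B * U) * Q - b \<cdot>\<^sub>m W - c \<cdot>\<^sub>m W'"
      unfolding V_def U(4) U'(4) using U(1) U'(1) by (simp only: minus smult)
    also have "\<dots> = Z"
      unfolding 1 using Z(1) Wc by (intro eq_matI) auto
    finally show ?thesis by simp
  qed
  ultimately show ?thesis using V by (auto simp: triangularised_def)
qed

lemma trace_similar:
  fixes U :: "real mat"
  assumes "U \<in> carrier_mat n n" "P \<in> carrier_mat n n" "Q \<in> carrier_mat n n" "Q * P = 1\<^sub>m n"
  shows "(\<Sum>i<n. (P * U * Q) $$ (i, i)) = (\<Sum>i<n. U $$ (i, i))"
proof -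
  have comm: "(\<Sum>i<n. (X * Y) $$ (i, i)) = (\<Sum>i<n. (Y * X) $$ (i, i))"
    if "X \<in> carrier_mat n n" "Y \<in> carrier_mat n n" for X Y :: "real mat"
  proof -
    have "(\<Sum>i<n. (X * Y) $$ (i, i)) = (\<Sum>i<n. \<Sum>j<n. X $$ (i, j) * Y $$ (j, i))"
      using that by (intro sum.cong) (auto simp: scalar_prod_def atLeast0LessThan)
    also have "\<dots> = (\<Sum>j<n. \<Sum>i<n. X $$ (i, j) * Y $$ (j, i))" by (rule sum.swap)
    also have "\<dots> = (\<Sum>i<n. (Y * X) $$ (i, i))"
      using that by (intro sum.cong) (auto simp: scalar_prod_def atLeast0LessThan mult.commute)
    finally show ?thesis .
  qed
  have "(\<Sum>i<n. (P * U * Q) $$ (i, i)) = (\<Sum>i<n. (Q * (P * U)) $$ (i, i))"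
    by (rule comm) (use assms in auto)
  also have "Q * (P * U) = U"
    using assms by (simp flip: assoc_mult_mat[of _ n n _ n _ n])
  finally show ?thesis .
qed

text \<open>The recurrence forces \<open>N r\<close> to be the polynomial
  \<open>three_term \<beta> \<gamma> r\<close> of \<open>A\<close>. Passing to a Schur form reduces
  the trace to a sum over the eigenvalues.\<close>

lemma sum_eigenvalues_three_term:
  fixes A :: "real mat"
  assumes A: "A \<in> carrier_mat n n" and sym: "transpose_mat A = A"
    and N: "\<And>r. N r \<in> carrier_mat n n" and N0: "N 0 = 1\<^sub>m n"
    and N1: "A * N 0 = N 1 + \<beta> 0 \<cdot>\<^sub>m N 0"
    and Nr: "\<And>r. A * N (Suc r) = N (Suc (Suc r)) + \<beta> (Suc r) \<cdot>\<^sub>m N (Suc r) + \<gamma> (Suc r) \<cdot>\<^sub>m N r"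
  shows "(\<Sum>i<n. N r $$ (i, i)) = (\<Sum>x\<in>#proots (char_poly A). three_term \<beta> \<gamma> r x)"
    and "size (proots (char_poly A)) = n"
proof -
  obtain es where es: "char_poly A = (\<Prod>e\<leftarrow>es. [:- e, 1:])" "length es = n"
    using symmetric_char_poly_splits[OF A sym] .
  have proots: "proots (char_poly A) = mset es" unfolding es(1) by (rule proots_prod_linear)
  then show "size (proots (char_poly A)) = n" using es by simp
  obtain B P Q where "schur_decomposition A es = (B, P, Q)" by (metis prod.collapse)
  from schur_decomposition[OF A es(1) this]
  have sim: "similar_mat_wit A B P Q" and B: "upper_triangular B" "diag_mat B = es" by auto
  note w = similar_mat_witD2[OF A sim]
  have one: "triangularised n B P Q (N 0) (three_term \<beta> \<gamma> 0)"
    unfolding triangularised_def using w(1,5,6) N0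
    by (intro bexI[of _ "1\<^sub>m n"]) auto
  have "triangularised n B P Q (N r) (three_term \<beta> \<gamma> r) \<and>
      triangularised n B P Q (N (Suc r)) (three_term \<beta> \<gamma> (Suc r))"
  proof (induction r)
    case 0
    \<comment> \<open>The first step has no predecessor: the general step is used with
      \<open>N 0\<close> in both places and coefficient \<open>0\<close> for the second.\<close>
    have "triangularised n B P Q (N 1)
        (\<lambda>x. (x - \<beta> 0) * three_term \<beta> \<gamma> 0 x - 0 * three_term \<beta> \<gamma> 0 x)"
    proof (rule triangularised_step[OF w(5) B(1) w(6,7,2) one one N])
      have "A * N 0 = N 1 + \<beta> 0 \<cdot>\<^sub>m N 0 + 0 \<cdot>\<^sub>m N 0"
        unfolding N1 using N[of 0] N[of 1] by (intro eq_matI) auto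
      then show "P * B * Q * N 0 = N 1 + \<beta> 0 \<cdot>\<^sub>m N 0 + 0 \<cdot>\<^sub>m N 0"
        using w(3) by simp
    qed
    moreover have "(\<lambda>x. (x - \<beta> 0) * three_term \<beta> \<gamma> 0 x - 0 * three_term \<beta> \<gamma> 0 x)
        = three_term \<beta> \<gamma> (Suc 0)" by auto
    ultimately show ?case using one by (simp only: One_nat_def simp_thms)
  next
    case (Suc r)
    have "triangularised n B P Q (N (Suc (Suc r)))
        (\<lambda>x. (x - \<beta> (Suc r)) * three_term \<beta> \<gamma> (Suc r) x - \<gamma> (Suc r) * three_term \<beta> \<gamma> r x)"
      by (rule triangularised_step[OF w(5) B(1) w(6,7,2) _ _ N, of "N (Suc r)" _ "N r"])
        (use Suc Nr[of r] w(3) in auto)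
    moreover have "(\<lambda>x. (x - \<beta> (Suc r)) * three_term \<beta> \<gamma> (Suc r) x - \<gamma> (Suc r) * three_term \<beta> \<gamma> r x)
        = three_term \<beta> \<gamma> (Suc (Suc r))" by auto
    ultimately show ?case using Suc by (simp only: simp_thms)
  qed
  then obtain U where U: "U \<in> carrier_mat n n" "N r = P * U * Q"
    "\<And>i. i < n \<Longrightarrow> U $$ (i, i) = three_term \<beta> \<gamma> r (B $$ (i, i))"
    unfolding triangularised_def by blast
  have "(\<Sum>i<n. N r $$ (i, i)) = (\<Sum>i<n. U $$ (i, i))"
    unfolding U(2) by (rule trace_similar) (use U w in auto)
  also have "\<dots> = (\<Sum>i<n. three_term \<beta> \<gamma> r (es ! i))"
    using U(3) B(2) w(5) by (intro sum.cong) (auto simp: diag_mat_def)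
  also have "\<dots> = (\<Sum>x\<in>#mset es. three_term \<beta> \<gamma> r x)"
    using es(2) by (simp add: sum_mset_sum_list sum_list_sum_nth atLeast0LessThan flip: mset_map)
  finally show "(\<Sum>i<n. N r $$ (i, i)) = (\<Sum>x\<in>#proots (char_poly A). three_term \<beta> \<gamma> r x)"
    unfolding proots .
qed

lemma sum_image_mset_eq_sum_count:
  fixes f :: "'a \<Rightarrow> real"
  assumes "finite S" "set_mset A \<subseteq> S"
  shows "(\<Sum>x\<in>#A. f x) = (\<Sum>a\<in>S. real (count A a) * f a)"
  using assms(2)
proof (induction A)
  case (add x A)
  have "(\<Sum>a\<in>S. real (count (add_mset x A) a) * f a)
      = (\<Sum>a\<in>S. (if a = x then f a else 0) + real (count A a) * f a)"
    by (rule sum.cong) (auto simp: algebra_simps)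
  also have "\<dots> = f x + (\<Sum>a\<in>S. real (count A a) * f a)"
    using add assms(1) by (simp add: sum.distrib sum.delta)
  finally show ?case using add by simp
qed simp

lemma integral_esd:
  assumes "f \<in> borel_measurable borel" "proots (char_poly A) \<noteq> {#}"
  shows "integral\<^sup>L (esd A) f = (\<Sum>x\<in>#proots (char_poly A). f x) / real (size (proots (char_poly A)))"
proof -
  let ?R = "proots (char_poly A)"
  have "integral\<^sup>L (esd A) f = integral\<^sup>L (measure_pmf (pmf_of_multiset ?R)) f"
    unfolding esd_def using assms(1) by (subst integral_distr) auto
  also have "\<dots> = (\<Sum>a\<in>set_mset ?R. f a * pmf (pmf_of_multiset ?R) a)"
    by (rule integral_measure_pmf_real) (use assms(2) in auto)
  also have "\<dots> = (\<Sum>a\<in>set_mset ?R. f a * (real (count ?R a) / real (size ?R)))"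
    using assms(2) by (intro sum.cong) auto
  also have "\<dots> = (\<Sum>a\<in>set_mset ?R. real (count ?R a) * f a) / real (size ?R)"
    by (simp add: sum_divide_distrib mult.commute)
  also have "(\<Sum>a\<in>set_mset ?R. real (count ?R a) * f a) = (\<Sum>x\<in>#?R. f x)"
    by (rule sum_image_mset_eq_sum_count[symmetric]) auto
  finally show ?thesis .
qed

section \<open>The Marchenko-Pastur law\<close>

lemma has_integral_cos_multiple:
  "((\<lambda>t. cos (real k * t)) has_integral (if k = 0 then pi else 0)) {0..pi}"
proof (cases "k = 0")
  case True
  then show ?thesis using has_integral_const_real[of "1::real" 0 pi] by simp
next
  case False
  have "((\<lambda>t. cos (real k * t)) has_integral (sin (real k * pi) / real k - sin (real k * 0) / real k)) {0..pi}"
  proof (rule fundamental_theorem_of_calculus)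
    fix t :: real
    show "((\<lambda>t. sin (real k * t) / real k) has_vector_derivative cos (real k * t)) (at t within {0..pi})"
      unfolding has_real_derivative_iff_has_vector_derivative[symmetric]
      using False by (auto intro!: derivative_eq_intros)
  qed simp
  then show ?thesis using False by (simp add: sin_npi)
qed

lemma has_integral_sin_times_sin:
  "((\<lambda>t. sin t * sin (real (Suc r) * t)) has_integral (if r = 0 then pi / 2 else 0)) {0..pi}"
proof -
  have "((\<lambda>t. (cos (real r * t) - cos (real (r + 2) * t)) / 2) has_integral
      ((if r = 0 then pi else 0) - (if r + 2 = 0 then pi else 0)) / 2) {0..pi}"
    by (intro has_integral_divide has_integral_diff has_integral_cos_multiple)
  moreover have "(cos (real r * t) - cos (real (r + 2) * t)) / 2 = sin t * sin (real (Suc r) * t)" for t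
  proof -
    have "real r * t = real (Suc r) * t - t" "real (r + 2) * t = real (Suc r) * t + t"
      by (auto simp: algebra_simps)
    then show ?thesis by (simp only: cos_diff cos_add) (simp add: algebra_simps)
  qed
  ultimately show ?thesis by (auto split: if_splits)
qed

context
  fixes s :: real
  assumes s: "0 < s" "s \<le> 1"
begin

text \<open>This is the squared modulus of \<open>1 - s * exp (i * t)\<close>. For \<open>t\<close>
  from \<open>0\<close> to \<open>pi\<close> it runs through the support of the law, from
  \<open>(1 - s)^2\<close> to \<open>(1 + s)^2\<close>.\<close>

definition "mp_arc t = 1 + s\<^sup>2 - 2 * s * cos t" for t :: real

text \<open>Up to the factor \<open>2 / pi * (- s) ^ r\<close>, the product of the density and the
  polynomial of degree \<open>r\<close> in the coordinate \<open>t\<close>.\<close>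

definition "mp_kernel r t = sin t * (sin (real (Suc r) * t) - s * sin (real r * t)) / mp_arc t" for r t

lemma mp_arc_ge: "(1 - s)\<^sup>2 \<le> mp_arc t"
proof -
  have "s * cos t \<le> s * 1" using s cos_le_one[of t] by (intro mult_left_mono) auto
  then show ?thesis by (simp add: mp_arc_def power2_eq_square algebra_simps)
qed

lemma mp_arc_pos:
  assumes "0 < t" "t \<le> pi"
  shows "0 < mp_arc t"
proof -
  have "cos t < cos 0" using assms by (intro cos_monotone_0_pi) auto
  then have "s * cos t < s * 1" using s by (intro mult_strict_left_mono) auto
  then have "(1 - s)\<^sup>2 < mp_arc t"
    by (simp add: mp_arc_def power2_eq_square algebra_simps)
  then show ?thesis by (smt (verit) zero_le_power2)
qed

lemma mp_kernel_borel [measurable]: "mp_kernel r \<in> borel_measurable borel"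
  unfolding mp_kernel_def mp_arc_def by measurable

text \<open>In \<open>mp_kernel r - s * mp_kernel (Suc r)\<close> the denominator cancels, leaving
  \<open>sin t * sin (real (Suc r) * t)\<close>. So the integrals \<open>K\<close> satisfy
  \<open>K r = s * K (Suc r)\<close> for \<open>r > 0\<close>. Being bounded, they vanish there upon
  iteration because \<open>s < 1\<close>, and the relation at \<open>r = 0\<close> gives
  \<open>K 0\<close>.\<close>

lemma mp_kernel_integral_lt_1:
  assumes "s < 1"
  shows "(mp_kernel r has_integral (if r = 0 then pi / 2 else 0)) {0..pi}"
proof -
  have pos: "mp_arc t > 0" for t
    using mp_arc_ge[of t] assms by (smt (verit) zero_less_power2)
  have cont: "continuous_on {0..pi} (mp_kernel r)" for r
    unfolding mp_kernel_def mp_arc_def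
    using pos by (intro continuous_intros) (auto simp: mp_arc_def less_imp_neq[symmetric])
  define K where "K r = integral {0..pi} (mp_kernel r)" for r
  have K: "(mp_kernel r has_integral K r) {0..pi}" for r
    unfolding K_def using integrable_continuous_real[OF cont] by (rule integrable_integral)
  have rec: "K r - s * K (Suc r) = (if r = 0 then pi / 2 else 0)" for r
  proof -
    have "((\<lambda>t. mp_kernel r t - s * mp_kernel (Suc r) t) has_integral K r - s * K (Suc r)) {0..pi}"
      by (intro has_integral_diff has_integral_mult_right K)
    moreover have "mp_kernel r t - s * mp_kernel (Suc r) t = sin t * sin (real (Suc r) * t)" for t
    proof -
      have e: "real r * t = real (Suc r) * t - t" "real (Suc (Suc r)) * t = real (Suc r) * t + t"
        by (auto simp: algebra_simps)
      define S where "S = real (Suc r) * t"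
      have "(mp_kernel r t - s * mp_kernel (Suc r) t) * mp_arc t =
          sin t * (sin S - s * sin (S - t)) - s * (sin t * (sin (S + t) - s * sin S))"
        using pos[of t] by (simp only: mp_kernel_def e S_def) (simp add: field_simps)
      also have "\<dots> = sin t * sin S * mp_arc t"
        by (simp add: sin_add sin_diff mp_arc_def power2_eq_square algebra_simps)
      finally show ?thesis using pos[of t] by (simp add: S_def)
    qed
    ultimately have "((\<lambda>t. sin t * sin (real (Suc r) * t)) has_integral K r - s * K (Suc r)) {0..pi}"
      by simp
    then show ?thesis using has_integral_sin_times_sin has_integral_unique by blast
  qed
  define C where "C = 2 / (1 - s)\<^sup>2 * pi"
  have bound: "\<bar>K r\<bar> \<le> C" for r
  proof -
    have "norm (K r) \<le> 2 / (1 - s)\<^sup>2 * Henstock_Kurzweil_Integration.content {0..pi}"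
    proof (rule has_integral_bound_real[OF _ _ K, of _ "{}"])
      show "0 \<le> 2 / (1 - s)\<^sup>2" by simp
    next
      show "finite ({} :: real set)" by simp
    next
      show "norm (mp_kernel r t) \<le> 2 / (1 - s)\<^sup>2" for t
      proof -
        have "\<bar>sin t * (sin (real (Suc r) * t) - s * sin (real r * t))\<bar> \<le> 1 * (1 + 1 * 1)"
          unfolding abs_mult
        proof (intro mult_mono)
          have "\<bar>sin (real (Suc r) * t) - s * sin (real r * t)\<bar> \<le>
              \<bar>sin (real (Suc r) * t)\<bar> + \<bar>s\<bar> * \<bar>sin (real r * t)\<bar>"
            by (metis abs_mult abs_triangle_ineq4)
          also have "\<dots> \<le> 1 + 1 * 1"
            using s by (intro add_mono mult_mono) auto
          finally show "\<bar>sin (real (Suc r) * t) - s * sin (real r * t)\<bar> \<le> 1 + 1 * 1" .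
        qed auto
        then have "\<bar>mp_kernel r t\<bar> \<le> 2 / mp_arc t"
          using pos[of t] by (simp add: mp_kernel_def divide_right_mono)
        also have "\<dots> \<le> 2 / (1 - s)\<^sup>2"
          using mp_arc_ge[of t] assms by (intro divide_left_mono) (auto intro!: mult_pos_pos pos)
        finally show ?thesis by simp
      qed
    qed
    then show ?thesis by (simp add: C_def)
  qed
  have K0: "K (Suc r) = 0" for r
  proof -
    have iter: "K (Suc r) = s ^ j * K (Suc r + j)" for j
    proof (induction j)
      case (Suc j)
      then show ?case using rec[of "Suc r + j"] by simp
    qed simp
    have "\<bar>K (Suc r)\<bar> \<le> s ^ j * C" for j
      using bound[of "Suc r + j"] s by (subst iter[of j]) (simp add: abs_mult mult_left_mono)
    moreover have "(\<lambda>j. s ^ j * C) \<longlonglongrightarrow> 0 * C"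
      by (intro tendsto_intros LIMSEQ_realpow_zero) (use s assms in auto)
    ultimately have "\<bar>K (Suc r)\<bar> \<le> 0 * C"
      by (intro LIMSEQ_le_const[of "\<lambda>j. s ^ j * C" "0 * C"]) auto
    then show ?thesis by simp
  qed
  have "K r = (if r = 0 then pi / 2 else 0)"
    using rec[of 0] K0 by (cases r) auto
  then show ?thesis using K[of r] by simp
qed

text \<open>For \<open>s = 1\<close> the kernel has a removable singularity at \<open>0\<close>, where its value is the junk \<open>0 / 0 = 0\<close>.\<close>

lemma mp_kernel_integral:
  "(LINT t|lborel. indicator {0..pi} t * mp_kernel r t) = (if r = 0 then pi / 2 else 0)"
proof -
  \<comment> \<open>A continuous version of the kernel. For \<open>s = 1\<close> the iteration above
    gives no decay, but the quotient simplifies to a mean of two cosines, integrated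
    directly.\<close>
  define h where "h = (if s = 1 then (\<lambda>t. (cos (real (Suc r) * t) + cos (real r * t)) / 2) else mp_kernel r)"
  have h: "(h has_integral (if r = 0 then pi / 2 else 0)) {0..pi}"
  proof (cases "s = 1")
    case True
    have "((\<lambda>t. (cos (real (Suc r) * t) + cos (real r * t)) / 2) has_integral
        ((if Suc r = 0 then pi else 0) + (if r = 0 then pi else 0)) / 2) {0..pi}"
      by (intro has_integral_divide has_integral_add has_integral_cos_multiple)
    then show ?thesis using True by (auto simp: h_def split: if_splits)
  next
    case False
    then show ?thesis using s mp_kernel_integral_lt_1 by (simp add: h_def)
  qed
  have cont: "continuous_on {0..pi} h"
  proof (cases "s = 1")
    case True
    then show ?thesis unfolding h_def by (auto intro!: continuous_intros)
  next
    case False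
    have pos: "mp_arc t > 0" for t
      using mp_arc_ge[of t] False s by (smt (verit) zero_less_power2)
    have "continuous_on {0..pi} (mp_kernel r)"
      unfolding mp_kernel_def mp_arc_def
      using pos by (intro continuous_intros) (auto simp: mp_arc_def less_imp_neq[symmetric])
    then show ?thesis using False by (simp add: h_def)
  qed
  have "h t = mp_kernel r t" if "0 < t" "t \<le> pi" for t
  proof (cases "s = 1")
    case True
    have p: "mp_arc t > 0" using mp_arc_pos that by blast
    have e: "real (Suc r) * t = real r * t + t" by (simp add: algebra_simps)
    have m: "mp_arc t = 2 * (1 - cos t)" unfolding mp_arc_def using True by simp
    have cc: "cos t * cos t = 1 - sin t * sin t"
      using sin_cos_squared_add[of t] by (simp add: power2_eq_square)
    \<comment> \<open>Stated for free variables so that only \<open>c * c + d * d = 1\<close> is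
      used of the trigonometric functions.\<close>
    have id: "(C * c - S * d + C) * (1 - c) = d * (S * c + C * d - S)"
      if "c * c = 1 - d * d" for C S c d :: real
    proof -
      have "(C * c - S * d + C) * (1 - c) = C * (1 - c * c) - S * d * (1 - c)"
        by (simp add: algebra_simps)
      then show ?thesis unfolding that by (simp add: algebra_simps)
    qed
    have "(cos (real (Suc r) * t) + cos (real r * t)) / 2 * mp_arc t
        = (cos (real r * t) * cos t - sin (real r * t) * sin t + cos (real r * t)) * (1 - cos t)"
      unfolding m e cos_add by simp
    also have "\<dots> = sin t * (sin (real r * t) * cos t + cos (real r * t) * sin t - sin (real r * t))"
      by (rule id[OF cc])
    also have "\<dots> = sin t * (sin (real (Suc r) * t) - s * sin (real r * t))"
      unfolding e sin_add using True by simp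
    finally have prod: "(cos (real (Suc r) * t) + cos (real r * t)) / 2 * mp_arc t
        = sin t * (sin (real (Suc r) * t) - s * sin (real r * t))" .
    have "h t = (cos (real (Suc r) * t) + cos (real r * t)) / 2"
      unfolding h_def if_P[OF True] ..
    also have "\<dots> = mp_kernel r t"
      unfolding mp_kernel_def nonzero_eq_divide_eq[OF less_imp_neq[OF p, symmetric]] by (rule prod)
    finally show ?thesis .
  qed (simp add: h_def)
  then have eq: "indicator {0..pi} t * mp_kernel r t = indicator {0..pi} t *\<^sub>R h t" if "t \<noteq> 0" for t
    using that by (auto simp: indicator_def)
  have int: "set_integrable lborel {0..pi} h"
    by (rule borel_integrable_atLeastAtMost'[OF cont])
  have "(LINT t|lborel. indicator {0..pi} t * mp_kernel r t) = (LINT t|lborel. indicator {0..pi} t *\<^sub>R h t)"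
  proof (rule integral_cong_AE)
    show "AE t in lborel. indicator {0..pi} t * mp_kernel r t = indicator {0..pi} t *\<^sub>R h t"
      using AE_lborel_singleton[of 0] by eventually_elim (rule eq)
    show "(\<lambda>t. indicator {0..pi} t *\<^sub>R h t) \<in> borel_measurable lborel"
      using int unfolding set_integrable_def by (rule borel_measurable_integrable)
  qed measurable
  also have "\<dots> = integral {0..pi} h"
    using set_borel_integral_eq_integral(2)[OF int] by (simp add: set_lebesgue_integral_def)
  also have "\<dots> = (if r = 0 then pi / 2 else 0)"
    using h by (rule integral_unique)
  finally show ?thesis .
qed

text \<open>Since \<open>mp_arc t - (1 + s^2) = - 2 * s * cos t\<close>, the recurrence is that of
  the Chebyshev polynomials of the second kind, rescaled by \<open>- s\<close>; the start value
  \<open>1\<close> adds the second sine. The factor \<open>sin t\<close> avoids a division at the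
  zeros of the sine.\<close>

lemma three_term_mp_arc:
  "sin t * three_term (\<lambda>r. if r = 0 then 1 else 1 + s\<^sup>2) (\<lambda>_. s\<^sup>2) r (mp_arc t)
    = (- s) ^ r * (sin (real (Suc r) * t) - s * sin (real r * t))"
proof (induction r rule: less_induct)
  case (less r)
  consider "r = 0" | "r = 1" | k where "r = Suc (Suc k)"
    by (metis One_nat_def old.nat.exhaust)
  then show ?case
  proof cases
    case 2
    have "real (Suc 1) * t = t + t" by simp
    then have "sin (real (Suc 1) * t) = 2 * sin t * cos t" by (simp only: sin_add) simp
    with 2 show ?thesis by (simp add: mp_arc_def power2_eq_square algebra_simps)
  next
    case 3
    define q where "q = three_term (\<lambda>r. if r = 0 then 1 else 1 + s\<^sup>2) (\<lambda>_. s\<^sup>2)"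
    define S where "S j = sin (real j * t)" for j
    have tt: "2 * cos t * S (Suc j) = S (Suc (Suc j)) + S j" for j
    proof -
      have e: "real j * t = real (Suc j) * t - t" "real (Suc (Suc j)) * t = real (Suc j) * t + t"
        by (auto simp: algebra_simps)
      show ?thesis unfolding S_def e by (simp only: sin_add sin_diff) (simp add: algebra_simps)
    qed
    have IH: "sin t * q k (mp_arc t) = (- s) ^ k * (S (Suc k) - s * S k)"
      "sin t * q (Suc k) (mp_arc t) = (- s) ^ Suc k * (S (Suc (Suc k)) - s * S (Suc k))"
      using less[of k] less[of "Suc k"] 3 by (auto simp: q_def S_def)
    have "sin t * q r (mp_arc t) = - 2 * s * cos t * (sin t * q (Suc k) (mp_arc t))
        - s\<^sup>2 * (sin t * q k (mp_arc t))"
      unfolding 3 by (simp add: q_def mp_arc_def algebra_simps)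
    also have "\<dots> = (- s) ^ Suc (Suc k) * ((2 * cos t * S (Suc (Suc k))) - s * (2 * cos t * S (Suc k))
        - (S (Suc k) - s * S k))"
      unfolding IH by (simp add: power2_eq_square algebra_simps)
    also have "\<dots> = (- s) ^ r * (S (Suc r) - s * S r)"
      unfolding tt 3 by (simp add: algebra_simps)
    finally show ?thesis by (simp add: q_def S_def)
  qed simp
qed

end

lemma three_term_borel [measurable]: "three_term \<beta> \<gamma> r \<in> borel_measurable borel"
proof (induction r rule: less_induct)
  case (less r)
  consider "r = 0" | "r = Suc 0" | k where "r = Suc (Suc k)"
    by (metis old.nat.exhaust)
  then show ?case
  proof cases
    case 3
    have [measurable]: "three_term \<beta> \<gamma> k \<in> borel_measurable borel"
      "three_term \<beta> \<gamma> (Suc k) \<in> borel_measurable borel"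
      using less 3 by auto
    have "three_term \<beta> \<gamma> r = (\<lambda>x. (x - \<beta> (Suc k)) * three_term \<beta> \<gamma> (Suc k) x - \<gamma> (Suc k) * three_term \<beta> \<gamma> k x)"
      using 3 by auto
    then show ?thesis by simp
  qed (auto intro!: measurable_cong[THEN iffD1, rotated])
qed

lemma marchenko_pastur_eq_distr:
  assumes "1 \<le> y"
  defines "s \<equiv> y powr (-1/2)"
  shows "marchenko_pastur y = distr (density lborel
      (\<lambda>t. ennreal (indicator {0..pi} t * (2 / pi * ((sin t)\<^sup>2 / mp_arc s t))))) borel (mp_arc s)"
proof (rule measure_eqI)
  have s: "0 < s" "s \<le> 1" using powr_mono[of "-1/2" 0 y] assms by (auto simp: s_def)
  have ys: "y * s\<^sup>2 = 1"
    using assms by (simp add: s_def power2_eq_square flip: powr_add)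
  define p where "p x = y / (2 * pi * x) * sqrt (((1 + s)\<^sup>2 - x) * (x - (1 - s)\<^sup>2))" for x
  have [measurable]: "p \<in> borel_measurable borel" unfolding p_def by measurable
  have [measurable]: "mp_arc s \<in> borel_measurable borel" unfolding mp_arc_def[OF s] by measurable
  have mp: "marchenko_pastur y = density lborel (\<lambda>x. ennreal (indicator {(1 - s)\<^sup>2..(1 + s)\<^sup>2} x * p x))"
    by (simp add: marchenko_pastur_def Let_def s_def p_def)
  have ends: "mp_arc s 0 = (1 - s)\<^sup>2" "mp_arc s pi = (1 + s)\<^sup>2"
    by (simp_all add: mp_arc_def[OF s] power2_eq_square algebra_simps)
  \<comment> \<open>The quantity \<open>2 * s * sin t\<close> appears twice, as the square root in
    the density and as the derivative of \<open>mp_arc s\<close>; then \<open>y * s^2 = 1\<close>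
    removes \<open>y\<close>.\<close>
  have p_arc: "p (mp_arc s t) * (2 * s * sin t) = 2 / pi * ((sin t)\<^sup>2 / mp_arc s t)" if "t \<in> {0..pi}" for t
  proof -
    have "((1 + s)\<^sup>2 - mp_arc s t) * (mp_arc s t - (1 - s)\<^sup>2) = 4 * s\<^sup>2 * (1 - (cos t)\<^sup>2)"
      by (simp add: mp_arc_def[OF s] power2_eq_square algebra_simps)
    also have "\<dots> = (2 * s * sin t)\<^sup>2" by (simp add: power_mult_distrib sin_squared_eq)
    finally have "sqrt (((1 + s)\<^sup>2 - mp_arc s t) * (mp_arc s t - (1 - s)\<^sup>2)) = 2 * s * sin t"
      using s that by (simp add: sin_ge_zero)
    then have "p (mp_arc s t) * (2 * s * sin t) = (y * s\<^sup>2) * (2 / pi * ((sin t)\<^sup>2 / mp_arc s t))"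
      by (simp add: p_def power2_eq_square)
    then show ?thesis by (simp only: ys)
  qed
  show "sets (marchenko_pastur y) = sets (distr (density lborel
      (\<lambda>t. ennreal (indicator {0..pi} t * (2 / pi * ((sin t)\<^sup>2 / mp_arc s t))))) borel (mp_arc s))"
    by (simp add: mp)
  fix A assume "A \<in> sets (marchenko_pastur y)"
  then have A[measurable]: "A \<in> sets borel" by (simp add: mp)
  have "emeasure (marchenko_pastur y) A =
      (\<integral>\<^sup>+x. ennreal (p x * indicator A x * indicator {mp_arc s 0..mp_arc s pi} x) \<partial>lborel)"
    unfolding mp using A
    by (subst emeasure_density) (auto intro!: nn_integral_cong simp: ends split: split_indicator)
  also have "\<dots> = (\<integral>\<^sup>+t. ennreal (p (mp_arc s t) * indicator A (mp_arc s t) * (2 * s * sin t)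
      * indicator {0..pi} t) \<partial>lborel)"
  proof (rule nn_integral_substitution[where g' = "\<lambda>t. 2 * s * sin t"])
    show "set_borel_measurable borel {mp_arc s 0..mp_arc s pi} (\<lambda>x. p x * indicator A x)"
      unfolding set_borel_measurable_def by measurable
    show "(mp_arc s has_real_derivative 2 * s * sin t) (at t)" for t
      unfolding mp_arc_def[OF s, abs_def] by (auto intro!: derivative_eq_intros)
    show "0 \<le> 2 * s * sin t" if "t \<in> {0..pi}" for t
      using s that sin_ge_zero[of t] by auto
  qed (auto intro!: continuous_intros)
  also have "\<dots> = (\<integral>\<^sup>+t. ennreal (indicator {0..pi} t * (2 / pi * ((sin t)\<^sup>2 / mp_arc s t)))
      * indicator (mp_arc s -` A) t \<partial>lborel)"
    using p_arc by (intro nn_integral_cong) (auto split: split_indicator simp: mult.assoc)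
  also have "\<dots> = emeasure (density lborel
      (\<lambda>t. ennreal (indicator {0..pi} t * (2 / pi * ((sin t)\<^sup>2 / mp_arc s t))))) (mp_arc s -` A)"
    using measurable_sets[OF \<open>mp_arc s \<in> borel_measurable borel\<close> A]
    by (subst emeasure_density) auto
  also have "\<dots> = emeasure (distr (density lborel
      (\<lambda>t. ennreal (indicator {0..pi} t * (2 / pi * ((sin t)\<^sup>2 / mp_arc s t))))) borel (mp_arc s)) A"
    by (subst emeasure_distr) auto
  finally show "emeasure (marchenko_pastur y) A = emeasure (distr (density lborel
      (\<lambda>t. ennreal (indicator {0..pi} t * (2 / pi * ((sin t)\<^sup>2 / mp_arc s t))))) borel (mp_arc s)) A" .
qed

text \<open>Of the two sines in the transformed density, one turns the polynomial into sines of
  multiples of \<open>t\<close> and the other stays in the kernel. The values \<open>1\<close> and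
  \<open>0\<close> are the limits to be matched by the random graphs.\<close>

lemma integral_marchenko_pastur_three_term:
  assumes "1 \<le> y"
  shows "integral\<^sup>L (marchenko_pastur y) (three_term (\<lambda>r. if r = 0 then 1 else 1 + 1 / y) (\<lambda>_. 1 / y) r)
          = (if r = 0 then 1 else 0)"
proof -
  define s where "s = y powr (-1/2)"
  have s: "0 < s" "s \<le> 1" using powr_mono[of "-1/2" 0 y] assms by (auto simp: s_def)
  have ys: "s\<^sup>2 = 1 / y"
    using assms by (simp add: s_def power2_eq_square flip: powr_add)
  have [measurable]: "mp_arc s \<in> borel_measurable borel" unfolding mp_arc_def[OF s] by measurable
  define q where "q = three_term (\<lambda>r. if r = 0 then 1 else 1 + s\<^sup>2) (\<lambda>_. s\<^sup>2) r"
  have [measurable]: "q \<in> borel_measurable borel" by (simp add: q_def)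
  have arc_nonneg: "0 \<le> mp_arc s t" for t
    using mp_arc_ge[OF s, of t] by (smt (verit) zero_le_power2)
  define w where "w t = indicator {0..pi} t * (2 / pi * ((sin t)\<^sup>2 / mp_arc s t))" for t
  have [measurable]: "w \<in> borel_measurable borel" unfolding w_def by measurable
  have "integral\<^sup>L (marchenko_pastur y) q = (LINT t|density lborel (\<lambda>t. ennreal (w t)). q (mp_arc s t))"
    unfolding marchenko_pastur_eq_distr[OF assms] s_def[symmetric] w_def by (rule integral_distr) simp_all
  also have "\<dots> = (LINT t|lborel. w t *\<^sub>R q (mp_arc s t))"
    by (rule integral_density) (use arc_nonneg in \<open>auto simp: w_def\<close>)
  also have "\<dots> = (LINT t|lborel. (2 / pi * (- s) ^ r) * (indicator {0..pi} t * mp_kernel s r t))"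
  proof (rule Bochner_Integration.integral_cong[OF refl])
    fix t
    have "(2 / pi * ((sin t)\<^sup>2 / mp_arc s t)) * q (mp_arc s t) = 2 / pi * (sin t * (sin t * q (mp_arc s t)) / mp_arc s t)"
      by (simp add: power2_eq_square)
    also have "\<dots> = (2 / pi * (- s) ^ r) * mp_kernel s r t"
      unfolding q_def three_term_mp_arc[OF s] by (simp add: mp_kernel_def[OF s])
    finally have 1: "(2 / pi * ((sin t)\<^sup>2 / mp_arc s t)) * q (mp_arc s t) = (2 / pi * (- s) ^ r) * mp_kernel s r t" .
    have "w t *\<^sub>R q (mp_arc s t) = indicator {0..pi} t * ((2 / pi * ((sin t)\<^sup>2 / mp_arc s t)) * q (mp_arc s t))"
      by (simp only: w_def real_scaleR_def mult.assoc)
    also have "\<dots> = (2 / pi * (- s) ^ r) * (indicator {0..pi} t * mp_kernel s r t)"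
      unfolding 1 by (simp only: ac_simps)
    finally show "w t *\<^sub>R q (mp_arc s t) = (2 / pi * (- s) ^ r) * (indicator {0..pi} t * mp_kernel s r t)" .
  qed
  also have "\<dots> = (if r = 0 then 1 else 0)"
    by (simp only: integral_mult_right_zero mp_kernel_integral[OF s]) simp
  finally show ?thesis unfolding q_def ys .
qed

lemma prob_space_marchenko_pastur:
  assumes "1 \<le> y"
  shows "prob_space (marchenko_pastur y)"
proof
  have "measure (marchenko_pastur y) (space (marchenko_pastur y)) = 1"
  proof -
    have "three_term \<beta> \<gamma> 0 = (\<lambda>_. 1)" for \<beta> \<gamma> by auto
    then show ?thesis using integral_marchenko_pastur_three_term[OF assms, of 0] by simp
  qed
  then show "emeasure (marchenko_pastur y) (space (marchenko_pastur y)) = 1"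
    \<comment> \<open>Infinite mass is excluded because \<open>measure\<close> would then be
      \<open>0\<close>, not \<open>1\<close>.\<close>
    by (smt (verit) emeasure_eq_ennreal_measure measure_def enn2real_top ennreal_1)
qed

lemma sets_marchenko_pastur: "sets (marchenko_pastur y) = sets borel"
  by (simp add: marchenko_pastur_def Let_def)

lemma AE_marchenko_pastur_bounded:
  assumes "1 \<le> y"
  shows "AE x in marchenko_pastur y. \<bar>x\<bar> \<le> 4"
proof -
  define s where "s = y powr (-1/2)"
  have s: "0 < s" "s \<le> 1" using powr_mono[of "-1/2" 0 y] assms by (auto simp: s_def)
  have "(1 + s)\<^sup>2 \<le> 2\<^sup>2" using s by (intro power_mono) auto
  then have bound: "\<bar>x\<bar> \<le> 4" if "x \<in> {(1 - s)\<^sup>2..(1 + s)\<^sup>2}" for x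
    using that order_trans[OF zero_le_power2[of "1 - s"], of x] by auto
  show ?thesis
    unfolding marchenko_pastur_def Let_def s_def[symmetric]
    by (subst AE_density) (use bound in \<open>auto split: split_indicator\<close>)
qed

section \<open>The method of moments\<close>

text \<open>The bound on the right grows slowly where the limit measure lives and dominates every
  polynomial of degree at most \<open>2 * N\<close> elsewhere.\<close>

lemma polynomial_approximation_with_tail:
  fixes f :: "real \<Rightarrow> real"
  assumes cont: "continuous_on UNIV f" and bdd: "bounded (range f)" and c: "0 < c" and e: "0 < e"
  obtains a :: "nat \<Rightarrow> real" and D C where "0 \<le> C"
    "\<forall>N x. D \<le> 2 * N \<longrightarrow> \<bar>f x - (\<Sum>i\<le>D. a i * x ^ i)\<bar> \<le> e + C * (x / c) ^ (2 * N)"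
proof -
  obtain g where g: "real_polynomial_function g" "\<And>x. x \<in> {-c..c} \<Longrightarrow> \<bar>f x - g x\<bar> < e"
    using Stone_Weierstrass_real_polynomial_function[OF compact_Icc continuous_on_subset[OF cont] e, of "-c" c]
    by auto
  obtain a D where ga: "g = (\<lambda>x. \<Sum>i\<le>D. a i * x ^ i)"
    using g(1) real_polynomial_function_iff_sum by blast
  obtain B where B: "\<And>x. \<bar>f x\<bar> \<le> B" using bdd by (auto simp: bounded_iff)
  \<comment> \<open>For \<open>t = \<bar>x\<bar> / c \<ge> 1\<close> both the bound \<open>B\<close>
    of \<open>f\<close> and each \<open>c ^ i * t ^ i\<close> with \<open>i \<le> D\<close> are
    controlled by \<open>t ^ (2 * N)\<close>. The constant does not depend on \<open>N\<close>,
    which can be chosen afterwards; the even exponent makes the tail a multiple of a moment.\<close>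
  define C where "C = B + (\<Sum>i\<le>D. \<bar>a i\<bar> * c ^ i)"
  have "0 \<le> B" using B[of 0] by linarith
  then have C: "0 \<le> C" unfolding C_def using c by (intro add_nonneg_nonneg sum_nonneg) auto
  show ?thesis
  proof (rule that[OF C], intro allI impI)
    fix N x assume N: "D \<le> 2 * N"
    have nn: "0 \<le> (x / c) ^ (2 * N)" by (rule zero_le_even_power) simp
    show "\<bar>f x - (\<Sum>i\<le>D. a i * x ^ i)\<bar> \<le> e + C * (x / c) ^ (2 * N)"
    proof (cases "\<bar>x\<bar> \<le> c")
      case True
      then have "\<bar>f x - g x\<bar> < e" by (intro g(2)) auto
      then show ?thesis using mult_nonneg_nonneg[OF C nn] unfolding ga by linarith
    next
      case False
      define t where "t = \<bar>x\<bar> / c"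
      have t: "1 \<le> t" using False c by (simp add: t_def)
      have tx: "t ^ (2 * N) = (x / c) ^ (2 * N)"
        by (simp add: t_def power_mult power_divide)
      have xt: "\<bar>x\<bar> = c * t" using c by (simp add: t_def)
      have "\<bar>\<Sum>i\<le>D. a i * x ^ i\<bar> \<le> (\<Sum>i\<le>D. \<bar>a i * x ^ i\<bar>)" by (rule sum_abs)
      also have "\<dots> \<le> (\<Sum>i\<le>D. (\<bar>a i\<bar> * c ^ i) * t ^ (2 * N))"
      proof (rule sum_mono)
        fix i assume "i \<in> {..D}"
        then have "t ^ i \<le> t ^ (2 * N)" using t N by (intro power_increasing) auto
        then have "(\<bar>a i\<bar> * c ^ i) * t ^ i \<le> (\<bar>a i\<bar> * c ^ i) * t ^ (2 * N)"
          using c by (intro mult_left_mono) auto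
        then show "\<bar>a i * x ^ i\<bar> \<le> (\<bar>a i\<bar> * c ^ i) * t ^ (2 * N)"
          by (simp add: abs_mult power_abs xt power_mult_distrib mult.assoc)
      qed
      finally have 1: "\<bar>\<Sum>i\<le>D. a i * x ^ i\<bar> \<le> (\<Sum>i\<le>D. \<bar>a i\<bar> * c ^ i) * t ^ (2 * N)"
        by (simp add: sum_distrib_right)
      have "1 \<le> t ^ (2 * N)" using t by simp
      then have "\<bar>f x\<bar> \<le> B * t ^ (2 * N)"
        using B[of x] \<open>0 \<le> B\<close> by (smt (verit) mult_left_le_one_le mult_le_cancel_left1)
      with 1 have "\<bar>f x - (\<Sum>i\<le>D. a i * x ^ i)\<bar> \<le> C * t ^ (2 * N)"
        unfolding C_def distrib_right by linarith
      then show ?thesis using e by (simp add: tx)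
    qed
  qed
qed

lemma (in prob_space) abs_expectation_diff_le:
  fixes f g h :: "'a \<Rightarrow> real"
  assumes "integrable M f" "integrable M g" "integrable M h"
    and "\<And>x. \<bar>f x - g x\<bar> \<le> e + h x"
  shows "\<bar>expectation f - expectation g\<bar> \<le> e + expectation h"
proof -
  have "\<bar>expectation f - expectation g\<bar> = \<bar>expectation (\<lambda>x. f x - g x)\<bar>"
    using assms by simp
  also have "\<dots> \<le> expectation (\<lambda>x. \<bar>f x - g x\<bar>)"
    by (rule integral_abs_bound)
  also have "\<dots> \<le> expectation (\<lambda>x. e + h x)"
    using assms by (intro integral_mono) auto
  also have "\<dots> = e + expectation h"
    using assms by (simp add: prob_space)
  finally show ?thesis .
qed

text \<open>The measures \<open>\<mu> k\<close> need not have a common bounded support, so mass far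
  out is controlled by one high moment. Approximating on twice the radius \<open>c\<close> makes
  that term at most \<open>C * (1/4) ^ N\<close> for \<open>\<nu>\<close>, and convergence of the
  moments carries the bound over to \<open>\<mu> k\<close>.\<close>

lemma moments_imp_weak_convergence:
  fixes \<mu> :: "nat \<Rightarrow> real measure" and \<nu> :: "real measure" and f :: "real \<Rightarrow> real"
  assumes \<mu>: "\<forall>\<^sub>F k in sequentially. prob_space (\<mu> k) \<and> sets (\<mu> k) = sets borel \<and>
      (\<forall>j. integrable (\<mu> k) (\<lambda>x. x ^ j))"
    and \<nu>: "prob_space \<nu>" "sets \<nu> = sets borel" "AE x in \<nu>. \<bar>x\<bar> \<le> c" and c: "0 < c"
    and moments: "\<And>j. (\<lambda>k. integral\<^sup>L (\<mu> k) (\<lambda>x. x ^ j)) \<longlonglongrightarrow> integral\<^sup>L \<nu> (\<lambda>x. x ^ j)"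
    and f: "continuous_on UNIV f" "bounded (range f)"
  shows "(\<lambda>k. integral\<^sup>L (\<mu> k) f) \<longlonglongrightarrow> integral\<^sup>L \<nu> f"
proof (rule tendstoI)
  interpret \<nu>: prob_space \<nu> by (rule \<nu>(1))
  obtain B where B: "\<And>x. \<bar>f x\<bar> \<le> B" using f(2) by (auto simp: bounded_iff)
  have [measurable]: "f \<in> borel_measurable borel" using f(1) by (rule borel_measurable_continuous_onI)
  have pow_int: "integrable \<nu> (\<lambda>x. x ^ j)" for j
  proof (rule \<nu>.integrable_const_bound)
    show "AE x in \<nu>. norm (x ^ j) \<le> c ^ j"
      using \<nu>(3) by eventually_elim (auto simp: power_abs intro: power_mono)
    show "(\<lambda>x. x ^ j) \<in> borel_measurable \<nu>"
      unfolding measurable_cong_sets[OF \<nu>(2) refl] by measurable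
  qed
  fix e0 :: real assume "0 < e0"
  \<comment> \<open>Replacing \<open>f\<close> by the polynomial \<open>g\<close> costs less than
    \<open>2 * e\<close> for each of the two measures, and comparing the integrals of
    \<open>g\<close> costs less than \<open>e\<close>.\<close>
  define e where "e = e0 / 6"
  have e: "0 < e" using \<open>0 < e0\<close> by (simp add: e_def)
  obtain a D C where C: "0 \<le> C"
    and approx: "\<forall>N x. D \<le> 2 * N \<longrightarrow> \<bar>f x - (\<Sum>i\<le>D. a i * x ^ i)\<bar> \<le> e + C * (x / (2 * c)) ^ (2 * N)"
    by (rule polynomial_approximation_with_tail[OF f, of "2 * c" e])
      (use c in simp, rule e, rule that)
  define g where "g x = (\<Sum>i\<le>D. a i * x ^ i)" for x :: real
  have "(\<lambda>N. C * (1/4) ^ N) \<longlonglongrightarrow> C * 0"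
    by (intro tendsto_intros LIMSEQ_realpow_zero) auto
  then have "\<forall>\<^sub>F N in sequentially. C * (1/4) ^ N < e"
    using e by (intro order_tendstoD(2)) auto
  then obtain N0 where "\<And>N. N \<ge> N0 \<Longrightarrow> C * (1/4) ^ N < e"
    by (auto simp: eventually_sequentially)
  then obtain N where N: "C * (1/4) ^ N < e" "D \<le> 2 * N"
    by (metis le_add1 le_add2 mult_2 trans_le_add1)
  define T where "T M = (C / (2 * c) ^ (2 * N)) * integral\<^sup>L M (\<lambda>x. x ^ (2 * N))" for M :: "real measure"
  have diff: "\<bar>integral\<^sup>L M f - integral\<^sup>L M g\<bar> \<le> e + T M"
    if M: "prob_space M" "sets M = sets borel" "\<And>j. integrable M (\<lambda>x. x ^ j)" for M
  proof -
    interpret M: prob_space M by (rule M(1))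
    have fM: "integrable M f"
      by (rule M.integrable_const_bound[where B = B])
        (use B in \<open>auto simp: measurable_cong_sets[OF M(2) refl]\<close>)
    have gM: "integrable M g" unfolding g_def using M(3) by auto
    have "\<bar>f x - g x\<bar> \<le> e + (C / (2 * c) ^ (2 * N)) * x ^ (2 * N)" for x
      using approx N(2) by (simp add: g_def power_divide)
    then have "\<bar>integral\<^sup>L M f - integral\<^sup>L M g\<bar> \<le> e + integral\<^sup>L M (\<lambda>x. (C / (2 * c) ^ (2 * N)) * x ^ (2 * N))"
      using fM gM M(3) by (intro M.abs_expectation_diff_le) auto
    then show ?thesis by (simp add: T_def)
  qed
  have T\<nu>: "T \<nu> < e"
  proof -
    have "integral\<^sup>L \<nu> (\<lambda>x. x ^ (2 * N)) \<le> integral\<^sup>L \<nu> (\<lambda>_. c ^ (2 * N))"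
    proof (rule integral_mono_AE)
      show "AE x in \<nu>. x ^ (2 * N) \<le> c ^ (2 * N)"
        using \<nu>(3)
      proof eventually_elim
        case (elim x)
        then have "\<bar>x\<bar> ^ (2 * N) \<le> c ^ (2 * N)" by (intro power_mono) auto
        moreover have "\<bar>x\<bar> ^ (2 * N) = x ^ (2 * N)" by (rule power_even_abs) simp
        ultimately show ?case by linarith
      qed
    qed (use pow_int in auto)
    then have "integral\<^sup>L \<nu> (\<lambda>x. x ^ (2 * N)) \<le> c ^ (2 * N)"
      by (simp add: \<nu>.prob_space)
    then have "T \<nu> \<le> (C / (2 * c) ^ (2 * N)) * c ^ (2 * N)"
      unfolding T_def using C c by (intro mult_left_mono) auto
    also have "\<dots> = C * (1/4) ^ N"
      using c by (simp add: power_mult_distrib power_mult power_divide)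
    finally show ?thesis using N(1) by linarith
  qed
  have diff\<nu>: "\<bar>integral\<^sup>L \<nu> f - integral\<^sup>L \<nu> g\<bar> \<le> e + T \<nu>"
    using \<nu>(1,2) pow_int by (rule diff)
  have "(\<lambda>k. T (\<mu> k)) \<longlonglongrightarrow> T \<nu>"
    unfolding T_def by (intro tendsto_intros moments)
  then have 1: "\<forall>\<^sub>F k in sequentially. T (\<mu> k) < e"
    using T\<nu> by (rule order_tendstoD(2))
  have int_g: "integral\<^sup>L M g = (\<Sum>i\<le>D. a i * integral\<^sup>L M (\<lambda>x. x ^ i))"
    if "\<And>j. integrable M (\<lambda>x. x ^ j)" for M
    unfolding g_def using that by (subst Bochner_Integration.integral_sum) auto
  have "(\<lambda>k. \<Sum>i\<le>D. a i * integral\<^sup>L (\<mu> k) (\<lambda>x. x ^ i)) \<longlonglongrightarrow> (\<Sum>i\<le>D. a i * integral\<^sup>L \<nu> (\<lambda>x. x ^ i))"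
    by (intro tendsto_intros moments)
  from tendstoD[OF this e]
  have 2: "\<forall>\<^sub>F k in sequentially. dist (\<Sum>i\<le>D. a i * integral\<^sup>L (\<mu> k) (\<lambda>x. x ^ i)) (integral\<^sup>L \<nu> g) < e"
    using pow_int by (simp add: int_g)
  show "\<forall>\<^sub>F k in sequentially. dist (integral\<^sup>L (\<mu> k) f) (integral\<^sup>L \<nu> f) < e0"
    using \<mu> 1 2
  proof eventually_elim
    case (elim k)
    then have "\<bar>integral\<^sup>L (\<mu> k) f - integral\<^sup>L (\<mu> k) g\<bar> \<le> e + T (\<mu> k)"
      by (intro diff) auto
    moreover have "\<bar>integral\<^sup>L (\<mu> k) g - integral\<^sup>L \<nu> g\<bar> < e"
      using elim by (simp add: int_g dist_real_def)
    ultimately show ?case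
      using diff\<nu> T\<nu> elim(2) e_def unfolding dist_real_def by linarith
  qed
qed

section \<open>From integrals of the recursive polynomials to moments\<close>

lemma integrable_power_times_three_term:
  assumes "\<And>j. integrable M (\<lambda>x. x ^ j)"
  shows "integrable M (\<lambda>x. x ^ j * three_term \<beta> \<gamma> r x)"
proof (induction r arbitrary: j rule: less_induct)
  case (less r)
  consider "r = 0" | "r = Suc 0" | k where "r = Suc (Suc k)"
    by (metis old.nat.exhaust)
  then show ?case
  proof cases
    case 1
    then show ?thesis using assms[of j] by simp
  next
    case 2
    have "x ^ j * three_term \<beta> \<gamma> r x = x ^ Suc j - \<beta> 0 * x ^ j" for x
      using 2 by (simp add: algebra_simps)
    then show ?thesis
      using assms[of j] assms[of "Suc j"] by (simp del: power_Suc)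
  next
    case 3
    have "x ^ j * three_term \<beta> \<gamma> r x = x ^ Suc j * three_term \<beta> \<gamma> (Suc k) x
        - \<beta> (Suc k) * (x ^ j * three_term \<beta> \<gamma> (Suc k) x) - \<gamma> (Suc k) * (x ^ j * three_term \<beta> \<gamma> k x)" for x
      using 3 by (simp add: algebra_simps)
    then show ?thesis
      using less[of "Suc k" j] less[of "Suc k" "Suc j"] less[of k j] 3 by (simp del: power_Suc three_term.simps)
  qed
qed

lemma integral_power_times_three_term:
  fixes \<beta> \<gamma> :: "nat \<Rightarrow> real"
  assumes "\<And>j. integrable M (\<lambda>x. x ^ j)"
  defines "I \<equiv> \<lambda>j r. integral\<^sup>L M (\<lambda>x. x ^ j * three_term \<beta> \<gamma> r x)"
  shows "I (Suc j) 0 = I j (Suc 0) + \<beta> 0 * I j 0"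
    and "I (Suc j) (Suc r) = I j (Suc (Suc r)) + \<beta> (Suc r) * I j (Suc r) + \<gamma> (Suc r) * I j r"
proof -
  note int = integrable_power_times_three_term[OF assms(1), of j \<beta> \<gamma>]
  have "x ^ Suc j * three_term \<beta> \<gamma> 0 x =
      x ^ j * three_term \<beta> \<gamma> (Suc 0) x + \<beta> 0 * (x ^ j * three_term \<beta> \<gamma> 0 x)" for x
    by (simp add: algebra_simps)
  then show "I (Suc j) 0 = I j (Suc 0) + \<beta> 0 * I j 0"
    unfolding I_def using int[of 0] int[of "Suc 0"] by (simp del: power_Suc three_term.simps)
  have "x ^ Suc j * three_term \<beta> \<gamma> (Suc r) x = x ^ j * three_term \<beta> \<gamma> (Suc (Suc r)) x
      + \<beta> (Suc r) * (x ^ j * three_term \<beta> \<gamma> (Suc r) x) + \<gamma> (Suc r) * (x ^ j * three_term \<beta> \<gamma> r x)" for x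
    by (simp add: algebra_simps)
  then show "I (Suc j) (Suc r) = I j (Suc (Suc r)) + \<beta> (Suc r) * I j (Suc r) + \<gamma> (Suc r) * I j r"
    unfolding I_def using int[of r] int[of "Suc r"] int[of "Suc (Suc r)"]
    by (simp del: power_Suc three_term.simps)
qed

text \<open>The recurrence trades one factor \<open>x\<close> for neighbouring indices
  \<open>r\<close>. Induction on \<open>j\<close>, for all \<open>r\<close> at once, reduces the
  integral of \<open>x ^ j\<close> times a polynomial to the case \<open>j = 0\<close>, with
  convergent coefficients. The polynomials may therefore vary with \<open>k\<close>.\<close>

lemma moments_tendsto_of_three_term:
  fixes \<mu> :: "nat \<Rightarrow> real measure" and \<nu> :: "real measure"
  assumes \<mu>: "\<forall>\<^sub>F k in sequentially. \<forall>j. integrable (\<mu> k) (\<lambda>x. x ^ j)"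
    and \<nu>: "\<And>j. integrable \<nu> (\<lambda>x. x ^ j)"
    and \<beta>: "\<And>r. (\<lambda>k. \<beta>k k r) \<longlonglongrightarrow> \<beta> r" and \<gamma>: "\<And>r. (\<lambda>k. \<gamma>k k (Suc r)) \<longlonglongrightarrow> \<gamma> (Suc r)"
    and base: "\<And>r. (\<lambda>k. integral\<^sup>L (\<mu> k) (three_term (\<beta>k k) (\<gamma>k k) r)) \<longlonglongrightarrow> integral\<^sup>L \<nu> (three_term \<beta> \<gamma> r)"
  shows "(\<lambda>k. integral\<^sup>L (\<mu> k) (\<lambda>x. x ^ j)) \<longlonglongrightarrow> integral\<^sup>L \<nu> (\<lambda>x. x ^ j)"
proof -
  define I where "I k j r = integral\<^sup>L (\<mu> k) (\<lambda>x. x ^ j * three_term (\<beta>k k) (\<gamma>k k) r x)" for k j r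
  define J where "J j r = integral\<^sup>L \<nu> (\<lambda>x. x ^ j * three_term \<beta> \<gamma> r x)" for j r
  have "(\<lambda>k. I k j r) \<longlonglongrightarrow> J j r" for r
  proof (induction j arbitrary: r)
    case 0
    then show ?case using base by (simp add: I_def J_def)
  next
    case (Suc j)
    show ?case
    proof (cases r)
      case 0
      have lim: "(\<lambda>k. I k j (Suc 0) + \<beta>k k 0 * I k j 0) \<longlonglongrightarrow> J j (Suc 0) + \<beta> 0 * J j 0"
        by (intro tendsto_intros Suc \<beta>)
      have J: "J (Suc j) 0 = J j (Suc 0) + \<beta> 0 * J j 0"
        unfolding J_def by (rule integral_power_times_three_term(1)[OF \<nu>])
      have ev: "\<forall>\<^sub>F k in sequentially. I k j (Suc 0) + \<beta>k k 0 * I k j 0 = I k (Suc j) 0"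
        using \<mu>
      proof eventually_elim
        case (elim k)
        show ?case unfolding I_def
          by (rule integral_power_times_three_term(1)[symmetric]) (use elim in blast)
      qed
      show ?thesis unfolding 0 J by (rule Lim_transform_eventually[OF lim ev])
    next
      case r: (Suc q)
      have lim: "(\<lambda>k. I k j (Suc (Suc q)) + \<beta>k k (Suc q) * I k j (Suc q) + \<gamma>k k (Suc q) * I k j q)
          \<longlonglongrightarrow> J j (Suc (Suc q)) + \<beta> (Suc q) * J j (Suc q) + \<gamma> (Suc q) * J j q"
        by (intro tendsto_intros Suc \<beta> \<gamma>)
      have J: "J (Suc j) (Suc q) = J j (Suc (Suc q)) + \<beta> (Suc q) * J j (Suc q) + \<gamma> (Suc q) * J j q"
        unfolding J_def by (rule integral_power_times_three_term(2)[OF \<nu>])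
      have ev: "\<forall>\<^sub>F k in sequentially. I k j (Suc (Suc q)) + \<beta>k k (Suc q) * I k j (Suc q)
          + \<gamma>k k (Suc q) * I k j q = I k (Suc j) (Suc q)"
        using \<mu>
      proof eventually_elim
        case (elim k)
        show ?case unfolding I_def
          by (rule integral_power_times_three_term(2)[symmetric]) (use elim in blast)
      qed
      show ?thesis unfolding r J by (rule Lim_transform_eventually[OF lim ev])
    qed
  qed
  from this[of 0] show ?thesis by (simp add: I_def J_def)
qed

section \<open>Convergence of the spectral distribution\<close>

lemma biadjacency_entry:
  assumes "X \<in> carrier_mat m n"
    and "adjacency_matrix (m + n) E = four_block_mat (0\<^sub>m m m) X (transpose_mat X) (0\<^sub>m n n)"
    and "i < m" "j < n"
  shows "X $$ (i, j) = of_bool (m + j \<in> neighbours E i)"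
proof -
  have "adjacency_matrix (m + n) E $$ (i, m + j) = X $$ (i, j)"
    unfolding assms(2) using assms(1,3,4) by (subst index_mat_four_block) auto
  moreover have "adjacency_matrix (m + n) E $$ (i, m + j) = of_bool (m + j \<in> neighbours E i)"
    using assms(3,4) by (simp add: adjacency_matrix_def in_neighbours)
  ultimately show ?thesis by simp
qed

text \<open>The Gram matrix counts paths of length 2 between right vertices, backtracking included.
  This ties the matrix to the recurrence of the walks.\<close>

lemma gram_sum_eq_two_steps:
  fixes f :: "nat \<Rightarrow> real"
  assumes E: "E \<in> biregular_graphs m n dL dR"
    and X: "X \<in> carrier_mat m n"
      "adjacency_matrix (m + n) E = four_block_mat (0\<^sub>m m m) X (transpose_mat X) (0\<^sub>m n n)"
    and i: "i < n"
  shows "(\<Sum>l<n. (transpose_mat X * X) $$ (i, l) * f (m + l))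
      = (\<Sum>u\<in>neighbours E (m + i). \<Sum>x\<in>neighbours E u. f x)"
proof -
  note entry = biadjacency_entry[OF X]
  have inner: "(\<Sum>l<n. X $$ (u, l) * f (m + l)) = (\<Sum>x\<in>neighbours E u. f x)" if u: "u < m" for u
  proof -
    have sub: "neighbours E u \<subseteq> {m..<m+n}" by (rule biregular_neighbours_left(1)[OF E u])
    have "(\<Sum>l<n. X $$ (u, l) * f (m + l)) = (\<Sum>l<n. (\<lambda>x. of_bool (x \<in> neighbours E u) * f x) (m + l))"
      using entry[OF u] by (intro sum.cong) auto
    also have "\<dots> = (\<Sum>x\<in>{m..<m+n}. of_bool (x \<in> neighbours E u) * f x)"
      by (rule sum.reindex_bij_witness[of _ "\<lambda>x. x - m" "\<lambda>l. m + l"]) auto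
    also have "\<dots> = (\<Sum>x\<in>neighbours E u. f x)"
      using sub by (intro sum.mono_neutral_cong_right) auto
    finally show ?thesis .
  qed
  have gram: "(transpose_mat X * X) $$ (i, l) = (\<Sum>u<m. X $$ (u, i) * X $$ (u, l))" if "l < n" for l
    using X(1) i that by (simp add: scalar_prod_def atLeast0LessThan)
  have "(\<Sum>l<n. (transpose_mat X * X) $$ (i, l) * f (m + l))
      = (\<Sum>l<n. \<Sum>u<m. X $$ (u, i) * (X $$ (u, l) * f (m + l)))"
    by (intro sum.cong) (auto simp: gram sum_distrib_right mult.assoc)
  also have "\<dots> = (\<Sum>u<m. \<Sum>l<n. X $$ (u, i) * (X $$ (u, l) * f (m + l)))"
    by (rule sum.swap)
  also have "\<dots> = (\<Sum>u<m. X $$ (u, i) * (\<Sum>x\<in>neighbours E u. f x))"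
    by (intro sum.cong) (auto simp: inner simp flip: sum_distrib_left)
  also have "\<dots> = (\<Sum>u\<in>neighbours E (m + i). \<Sum>x\<in>neighbours E u. f x)"
    using biregular_neighbours_right(1)[OF E, of "m + i"] i entry neighbours_sym[of _ E "m + i"]
    by (intro sum.mono_neutral_cong_right) auto
  finally show ?thesis .
qed

text \<open>From right to right there are \<open>dR - 1\<close> and \<open>dL - 1\<close> ways to
  backtrack in a single step; at the start all \<open>dR\<close> neighbours return, hence the
  exceptional value \<open>dR / dR = 1\<close>.\<close>

definition nb_beta :: "nat \<Rightarrow> nat \<Rightarrow> nat \<Rightarrow> real" where
  "nb_beta dL dR r = (if r = 0 then 1 else (real dR + real dL - 2) / real dR)"

text \<open>At \<open>r = 1\<close> the full degree \<open>dR\<close> replaces \<open>dR - 1\<close>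
  and cancels one power of \<open>dR\<close>.\<close>

definition nb_gamma :: "nat \<Rightarrow> nat \<Rightarrow> nat \<Rightarrow> real" where
  "nb_gamma dL dR r = (if r = 1 then (real dL - 1) / real dR
     else (real dR - 1) * (real dL - 1) / (real dR)\<^sup>2)"

text \<open>The three-term recurrence of the polynomials is that of the numbers of non-backtracking walks
  between right vertices, divided by \<open>dR ^ r\<close>.\<close>

lemma sum_eigenvalues_eq_nb_count:
  assumes E: "E \<in> biregular_graphs m n dL dR" and dR: "0 < dR"
    and X: "X \<in> carrier_mat m n"
      "adjacency_matrix (m + n) E = four_block_mat (0\<^sub>m m m) X (transpose_mat X) (0\<^sub>m n n)"
  defines "R \<equiv> proots (char_poly ((1 / real dR) \<cdot>\<^sub>m (transpose_mat X * X)))"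
  shows "(\<Sum>x\<in>#R. three_term (nb_beta dL dR) (nb_gamma dL dR) r x)
      = (\<Sum>i<n. nb_count E (2 * r) (m + i) (m + i)) / real dR ^ r"
    and "size R = n"
proof -
  define A where "A = (1 / real dR) \<cdot>\<^sub>m (transpose_mat X * X)"
  define N where "N r = Matrix.mat n n (\<lambda>(i, j). nb_count E (2 * r) (m + i) (m + j) / real dR ^ r)" for r
  have A: "A \<in> carrier_mat n n" using X(1) by (simp add: A_def)
  define S where "S = transpose_mat X * X"
  have S: "S \<in> carrier_mat n n" "transpose_mat S = S"
    using X(1) transpose_mult[of "transpose_mat X" n m X n] by (auto simp: S_def)
  have "S $$ (j, i) = S $$ (i, j)" if "i < n" "j < n" for i j
    using S that by (metis carrier_matD index_transpose_mat(1))
  then have sym: "transpose_mat A = A"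
    using S(1) unfolding A_def S_def[symmetric] by (intro eq_matI) auto
  have N: "N r \<in> carrier_mat n n" for r by (simp add: N_def)
  have AN: "(A * N r) $$ (i, j)
      = (\<Sum>u\<in>neighbours E (m + i). \<Sum>x\<in>neighbours E u. nb_count E (2 * r) x (m + j)) / real dR ^ Suc r"
    if "i < n" "j < n" for r i j
  proof -
    have "(A * N r) $$ (i, j) = (\<Sum>l<n. A $$ (i, l) * N r $$ (l, j))"
      using A N[of r] that by (simp add: scalar_prod_def atLeast0LessThan)
    also have "\<dots> = (\<Sum>l<n. (transpose_mat X * X) $$ (i, l) * nb_count E (2 * r) (m + l) (m + j)) / real dR ^ Suc r"
      unfolding sum_divide_distrib
      using X(1) that by (intro sum.cong) (auto simp: A_def N_def)
    finally show ?thesis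
      by (subst (asm) gram_sum_eq_two_steps[OF E X that(1), of "\<lambda>x. nb_count E (2 * r) x (m + j)"])
  qed
  have two: "nb_count E (2 * Suc 0) = nb_count E 2" "nb_count E (2 * Suc (Suc 0)) = nb_count E 4"
    by simp_all
  have pos: "real dR > 0" using dR by simp
  have N0: "N 0 = 1\<^sub>m n"
    by (rule eq_matI) (auto simp: N_def nb_count_0)
  have N1: "A * N 0 = N 1 + nb_beta dL dR 0 \<cdot>\<^sub>m N 0"
  proof (rule eq_matI)
    fix i j assume "i < dim_row (N 1 + nb_beta dL dR 0 \<cdot>\<^sub>m N 0)" "j < dim_col (N 1 + nb_beta dL dR 0 \<cdot>\<^sub>m N 0)"
    then have ij: "i < n" "j < n" by (auto simp: N_def)
    have u: "m \<le> m + i" "m + i < m + n" using ij by auto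
    show "(A * N 0) $$ (i, j) = (N 1 + nb_beta dL dR 0 \<cdot>\<^sub>m N 0) $$ (i, j)"
      unfolding AN[OF ij] mult_0_right nb_count_two_steps(1)[OF E u]
      using ij pos by (simp add: N_def nb_beta_def field_simps numeral_2_eq_2)
  qed (use A N in \<open>auto simp: N_def\<close>)
  have Nr: "A * N (Suc r) = N (Suc (Suc r)) + nb_beta dL dR (Suc r) \<cdot>\<^sub>m N (Suc r)
      + nb_gamma dL dR (Suc r) \<cdot>\<^sub>m N r" for r
  proof (rule eq_matI)
    fix i j assume "i < dim_row (N (Suc (Suc r)) + nb_beta dL dR (Suc r) \<cdot>\<^sub>m N (Suc r)
      + nb_gamma dL dR (Suc r) \<cdot>\<^sub>m N r)" "j < dim_col (N (Suc (Suc r)) + nb_beta dL dR (Suc r) \<cdot>\<^sub>m N (Suc r)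
      + nb_gamma dL dR (Suc r) \<cdot>\<^sub>m N r)"
    then have ij: "i < n" "j < n" by (auto simp: N_def)
    have u: "m \<le> m + i" "m + i < m + n" using ij by auto
    show "(A * N (Suc r)) $$ (i, j) = (N (Suc (Suc r)) + nb_beta dL dR (Suc r) \<cdot>\<^sub>m N (Suc r)
      + nb_gamma dL dR (Suc r) \<cdot>\<^sub>m N r) $$ (i, j)"
    proof (cases r)
      case 0
      show ?thesis
        unfolding AN[OF ij] 0 two nb_count_two_steps(2)[OF E u]
        using ij pos by (simp add: N_def nb_beta_def nb_gamma_def field_simps numeral_eq_Suc)
    next
      case (Suc q)
      have s: "3 \<le> 2 * Suc r" "2 * Suc r + 2 = 2 * Suc (Suc r)" "2 * Suc r - 2 = 2 * r"
        using Suc by auto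
      have g: "nb_gamma dL dR (Suc r) = (real dR - 1) * (real dL - 1) / (real dR)\<^sup>2"
        using Suc by (simp add: nb_gamma_def)
      define c0 c1 c2 where "c0 = nb_count E (2 * r) (m + i) (m + j)"
        and "c1 = nb_count E (2 * Suc r) (m + i) (m + j)"
        and "c2 = nb_count E (2 * Suc (Suc r)) (m + i) (m + j)"
      have "(A * N (Suc r)) $$ (i, j) = (c2 + (real dR + real dL - 2) * c1
          + (real dR - 1) * (real dL - 1) * c0) / real dR ^ Suc (Suc r)"
        unfolding AN[OF ij] nb_count_two_steps(3)[OF E u s(1)] s(2,3) c0_def c1_def c2_def ..
      also have "\<dots> = c2 / real dR ^ Suc (Suc r) + nb_beta dL dR (Suc r) * (c1 / real dR ^ Suc r)
          + nb_gamma dL dR (Suc r) * (c0 / real dR ^ r)"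
        unfolding g using pos by (simp add: nb_beta_def add_divide_distrib power2_eq_square)
      also have "\<dots> = (N (Suc (Suc r)) + nb_beta dL dR (Suc r) \<cdot>\<^sub>m N (Suc r)
          + nb_gamma dL dR (Suc r) \<cdot>\<^sub>m N r) $$ (i, j)"
        using ij by (simp add: N_def c0_def c1_def c2_def)
      finally show ?thesis .
    qed
  qed (use A N in \<open>auto simp: N_def\<close>)
  have eig: "(\<Sum>i<n. N r $$ (i, i)) = (\<Sum>x\<in>#proots (char_poly A). three_term (nb_beta dL dR) (nb_gamma dL dR) r x)"
    "size (proots (char_poly A)) = n"
    using sum_eigenvalues_three_term[OF A sym N N0 N1 Nr] by auto
  then show "size R = n" by (simp add: R_def A_def)
  have "(\<Sum>i<n. N r $$ (i, i)) = (\<Sum>i<n. nb_count E (2 * r) (m + i) (m + i)) / real dR ^ r"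
    by (simp add: N_def sum_divide_distrib)
  then show "(\<Sum>x\<in>#R. three_term (nb_beta dL dR) (nb_gamma dL dR) r x)
      = (\<Sum>i<n. nb_count E (2 * r) (m + i) (m + i)) / real dR ^ r"
    using eig(1) by (simp add: R_def A_def)
qed

lemma sum_nb_count_le_closed_nb_walks:
  assumes E: "E \<in> biregular_graphs m n dL dR" and s: "0 < s"
  shows "(\<Sum>i<n. nb_count E s (m + i) (m + i)) \<le> real (card (closed_nb_walks E {..<m+n} s))"
proof -
  note fin = biregular_finite_Union[OF E]
  have "(\<Sum>i<n. card (nb_walks E s (m + i) (m + i))) = card (\<Union>i<n. nb_walks E s (m + i) (m + i))"
    by (rule card_UN_disjoint[symmetric]) (auto simp: finite_nb_walks[OF fin], auto simp: nb_walks_def)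
  also have "\<dots> \<le> card (closed_nb_walks E {..<m+n} s)"
  proof (rule card_mono)
    show "(\<Union>i<n. nb_walks E s (m + i) (m + i)) \<subseteq> closed_nb_walks E {..<m+n} s"
    proof
      fix p assume "p \<in> (\<Union>i<n. nb_walks E s (m + i) (m + i))"
      then have p: "length p = Suc s" "hd p = last p" "edges p \<subseteq> E" "nonbacktracking p"
        by (auto simp: nb_walks_def)
      \<comment> \<open>Since \<open>s > 0\<close>, every vertex of the walk lies on one of its
        edges.\<close>
      have "set p \<subseteq> \<Union>(edges p)" using p s by (intro set_subset_Union_edges) auto
      also have "\<dots> \<subseteq> {..<m+n}" using p(3) biregular_subset_Pow[OF E] by blast
      finally show "p \<in> closed_nb_walks E {..<m+n} s" using p by (auto simp: closed_nb_walks_def)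
    qed
  qed (simp add: finite_closed_nb_walks)
  finally show ?thesis
    unfolding nb_count_def of_nat_sum[symmetric] of_nat_le_iff .
qed

lemma prob_space_esd_integrable_power:
  assumes "proots (char_poly A) \<noteq> {#}"
  shows "prob_space (esd A) \<and> sets (esd A) = sets borel \<and> (\<forall>j. integrable (esd A) (\<lambda>x. x ^ j))"
proof -
  have "prob_space (esd A)"
    unfolding esd_def by (rule prob_space.prob_space_distr[OF prob_space_measure_pmf]) simp
  moreover have "integrable (esd A) (\<lambda>x. x ^ j)" for j
    unfolding esd_def using assms
    by (subst integrable_distr_eq) (auto intro: integrable_measure_pmf_finite)
  ultimately show ?thesis by (simp add: esd_def)
qed

lemma nb_coefficients_tendsto:
  fixes dL dR :: "nat \<Rightarrow> nat"
  assumes dR: "filterlim dR at_top sequentially"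
    and y: "(\<lambda>k. real (dR k) / real (dL k)) \<longlonglongrightarrow> y" "1 \<le> y"
  shows "(\<lambda>k. nb_beta (dL k) (dR k) r) \<longlonglongrightarrow> (if r = 0 then 1 else 1 + 1 / y)"
    and "(\<lambda>k. nb_gamma (dL k) (dR k) r) \<longlonglongrightarrow> 1 / y"
proof -
  have "filterlim (\<lambda>k. real (dR k)) at_top sequentially"
    by (rule filterlim_compose[OF filterlim_real_sequentially dR])
  then have inv: "(\<lambda>k. 1 / real (dR k)) \<longlonglongrightarrow> 0"
    by (intro tendsto_divide_0[OF tendsto_const] filterlim_at_top_imp_at_infinity)
  have "(\<lambda>k. 1 / (real (dR k) / real (dL k))) \<longlonglongrightarrow> 1 / y"
    using y by (intro tendsto_intros) auto
  \<comment> \<open>With division by zero equal to zero, this also covers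
    \<open>dL k = 0\<close>.\<close>
  then have q: "(\<lambda>k. real (dL k) / real (dR k)) \<longlonglongrightarrow> 1 / y" by simp
  have pos: "\<forall>\<^sub>F k in sequentially. 0 < dR k"
  proof -
    have "\<forall>\<^sub>F k in sequentially. 1 \<le> dR k" using dR by (simp add: filterlim_at_top)
    then show ?thesis by eventually_elim simp
  qed
  have b: "(\<lambda>k. 1 + real (dL k) / real (dR k) - 2 * (1 / real (dR k))) \<longlonglongrightarrow> 1 + 1 / y - 2 * 0"
    by (intro tendsto_intros q inv)
  show "(\<lambda>k. nb_beta (dL k) (dR k) r) \<longlonglongrightarrow> (if r = 0 then 1 else 1 + 1 / y)"
  proof (cases "r = 0")
    case False
    have "\<forall>\<^sub>F k in sequentially. 1 + real (dL k) / real (dR k) - 2 * (1 / real (dR k)) = nb_beta (dL k) (dR k) r"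
      using pos by eventually_elim (use False in \<open>auto simp: nb_beta_def field_simps\<close>)
    from Lim_transform_eventually[OF b this] show ?thesis using False by simp
  qed (simp add: nb_beta_def)
  have g1: "(\<lambda>k. real (dL k) / real (dR k) - 1 / real (dR k)) \<longlonglongrightarrow> 1 / y - 0"
    by (intro tendsto_intros q inv)
  have g: "(\<lambda>k. (1 - 1 / real (dR k)) * (real (dL k) / real (dR k) - 1 / real (dR k))) \<longlonglongrightarrow> (1 - 0) * (1 / y - 0)"
    by (intro tendsto_intros q inv)
  show "(\<lambda>k. nb_gamma (dL k) (dR k) r) \<longlonglongrightarrow> 1 / y"
  proof (cases "r = 1")
    case True
    then show ?thesis using g1 by (simp add: nb_gamma_def diff_divide_distrib)
  next
    case False
    have "\<forall>\<^sub>F k in sequentially. (1 - 1 / real (dR k)) * (real (dL k) / real (dR k) - 1 / real (dR k))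
        = nb_gamma (dL k) (dR k) r"
      using pos by eventually_elim (use False in \<open>auto simp: nb_gamma_def field_simps power2_eq_square\<close>)
    from Lim_transform_eventually[OF g this] show ?thesis by simp
  qed
qed

theorem theorem1:
  fixes M :: "'w measure"
    and m n dL dR :: "nat \<Rightarrow> nat"
    and G :: "nat \<Rightarrow> 'w \<Rightarrow> nat set set"
    and X :: "nat \<Rightarrow> 'w \<Rightarrow> real mat"
    and y :: real
  assumes "prob_space M"
    and "strict_mono n"
    and "\<And>k. dL k \<le> dR k"
    and "\<And>k. random_biregular_graph M (m k) (n k) (dL k) (dR k) (G k)"
    and "filterlim dR at_top sequentially"
    and "\<And>\<epsilon>::real. \<epsilon> > 0 \<Longrightarrow> (\<lambda>k. real (dR k)) \<in> o(\<lambda>k. real (n k) powr \<epsilon>)"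
    and "(\<lambda>k. real (dR k) / real (dL k)) \<longlonglongrightarrow> y"
    and "1 \<le> y"
    and "\<And>k \<omega>. \<omega> \<in> space M \<Longrightarrow> X k \<omega> \<in> carrier_mat (m k) (n k)"
    and "\<And>k \<omega>. \<omega> \<in> space M \<Longrightarrow>
           adjacency_matrix (m k + n k) (G k \<omega>) =
             four_block_mat (0\<^sub>m (m k) (m k)) (X k \<omega>)
                            (transpose_mat (X k \<omega>)) (0\<^sub>m (n k) (n k))"
  shows "converges_almost_surely M
           (\<lambda>k \<omega>. esd ((1 / real (dR k)) \<cdot>\<^sub>m (transpose_mat (X k \<omega>) * X k \<omega>)))
           (marchenko_pastur y)"
proof -
  interpret prob_space M by fact
  have small: "\<forall>\<epsilon>::real. \<epsilon> > 0 \<longrightarrow> (\<lambda>k. real (dR k)) \<in> o(\<lambda>k. real (n k) powr \<epsilon>)"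
    using assms(6) by blast
  define \<mu> where "\<mu> k \<omega> = esd ((1 / real (dR k)) \<cdot>\<^sub>m (transpose_mat (X k \<omega>) * X k \<omega>))" for k \<omega>
  interpret mp: prob_space "marchenko_pastur y" by (rule prob_space_marchenko_pastur) fact
  have mp_pow: "integrable (marchenko_pastur y) (\<lambda>x. x ^ j)" for j
  proof (rule mp.integrable_const_bound)
    show "AE x in marchenko_pastur y. norm (x ^ j) \<le> 4 ^ j"
      using AE_marchenko_pastur_bounded[OF assms(8)]
      by eventually_elim (auto simp: power_abs intro: power_mono)
    show "(\<lambda>x. x ^ j) \<in> borel_measurable (marchenko_pastur y)"
      unfolding measurable_cong_sets[OF sets_marchenko_pastur refl] by measurable
  qed
  have large: "\<forall>\<^sub>F k in sequentially. 0 < dR k \<and> 0 < n k \<and> k \<le> n k"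
    using eventually_degrees_small[OF assms(2,3,5) small, of 0] by eventually_elim auto
  \<comment> \<open>Randomness is gone from here on: a fixed sample point with few closed walks of
    every even length is treated deterministically.\<close>
  have conv: "(\<lambda>k. integral\<^sup>L (\<mu> k \<omega>) f) \<longlonglongrightarrow> integral\<^sup>L (marchenko_pastur y) f"
    if \<omega>: "\<omega> \<in> space M" and few: "\<And>r. \<forall>\<^sub>F k in sequentially.
        real (card (closed_nb_walks (G k \<omega>) {..<m k + n k} (2 * Suc r))) < real (n k) powr (7/8)"
      and f: "continuous_on UNIV f" "bounded (range f)" for \<omega> and f :: "real \<Rightarrow> real"
  proof -
    have E: "G k \<omega> \<in> biregular_graphs (m k) (n k) (dL k) (dR k)" for k
      by (rule random_biregular_graph_in[OF assms(4) \<omega>])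
    note X = assms(9)[OF \<omega>] assms(10)[OF \<omega>]
    define R where "R k = proots (char_poly ((1 / real (dR k)) \<cdot>\<^sub>m (transpose_mat (X k \<omega>) * X k \<omega>)))" for k
    have R: "size (R k) = n k" if "0 < dR k" for k
      unfolding R_def by (rule sum_eigenvalues_eq_nb_count(2)[OF E that X])
    have ne: "R k \<noteq> {#}" if "0 < dR k" "0 < n k" for k
      using R[OF that(1)] that(2) by auto
    have nice: "\<forall>\<^sub>F k in sequentially. prob_space (\<mu> k \<omega>) \<and> sets (\<mu> k \<omega>) = sets borel \<and>
        (\<forall>j. integrable (\<mu> k \<omega>) (\<lambda>x. x ^ j))"
      using large by eventually_elim (use ne in \<open>simp add: \<mu>_def R_def prob_space_esd_integrable_power\<close>)
    define I where "I k r = integral\<^sup>L (\<mu> k \<omega>)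
        (three_term (nb_beta (dL k) (dR k)) (nb_gamma (dL k) (dR k)) r)" for k r
    have I: "I k r = (\<Sum>i<n k. nb_count (G k \<omega>) (2 * r) (m k + i) (m k + i)) / real (dR k) ^ r / real (n k)"
      if "0 < dR k" "0 < n k" for k r
      unfolding I_def \<mu>_def
      using ne[OF that] R[OF that(1)] sum_eigenvalues_eq_nb_count(1)[OF E that(1) X, of r]
      by (subst integral_esd) (auto simp: R_def)
    have "(\<lambda>k. I k r) \<longlonglongrightarrow> integral\<^sup>L (marchenko_pastur y)
        (three_term (\<lambda>r. if r = 0 then 1 else 1 + 1 / y) (\<lambda>_. 1 / y) r)" for r
    proof (cases r)
      case 0
      have "\<forall>\<^sub>F k in sequentially. 1 = I k 0"
        using large by eventually_elim (simp add: I nb_count_0)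
      then have "(\<lambda>k. I k 0) \<longlonglongrightarrow> 1" by (rule Lim_transform_eventually[OF tendsto_const])
      then show ?thesis using integral_marchenko_pastur_three_term[OF assms(8), of 0] 0 by simp
    next
      case (Suc q)
      have "(\<lambda>k. I k r) \<longlonglongrightarrow> 0"
      proof (rule tendsto_sandwich[OF _ _ tendsto_const])
        show "\<forall>\<^sub>F k in sequentially. 0 \<le> I k r"
          using large by eventually_elim (auto simp: I nb_count_def intro!: divide_nonneg_nonneg sum_nonneg)
        show "\<forall>\<^sub>F k in sequentially. I k r \<le> real k powr (-1/8)"
          using large few[of q] eventually_gt_at_top[of 0]
        proof eventually_elim
          case (elim k)
          have pos: "0 < dR k" "0 < n k" using elim by auto
          define T where "T = (\<Sum>i<n k. nb_count (G k \<omega>) (2 * r) (m k + i) (m k + i))"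
          have T: "0 \<le> T" unfolding T_def nb_count_def by (intro sum_nonneg) auto
          have "T \<le> real (card (closed_nb_walks (G k \<omega>) {..<m k + n k} (2 * r)))"
            unfolding T_def by (rule sum_nb_count_le_closed_nb_walks[OF E]) (simp add: Suc)
          also have "\<dots> \<le> real (n k) powr (7/8)" using elim Suc by simp
          finally have T2: "T \<le> real (n k) powr (7/8)" .
          \<comment> \<open>The power of \<open>dR\<close> can only help and is discarded; the decay
            comes from the division by \<open>n\<close>.\<close>
          have "1 \<le> real (dR k) ^ r" using pos by (intro one_le_power) auto
          then have "T / real (dR k) ^ r \<le> T / 1" using T pos by (intro divide_left_mono) auto
          then have "I k r \<le> real (n k) powr (7/8) / real (n k)"
            using T2 unfolding I[OF pos] T_def[symmetric] by (intro divide_right_mono) auto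
          also have "\<dots> = real (n k) powr (7/8) / real (n k) powr 1" using pos by simp
          also have "\<dots> = real (n k) powr (-1/8)"
            using powr_diff[of "real (n k)" "7/8" 1] by simp
          also have "\<dots> \<le> real k powr (-1/8)" using elim by (intro powr_mono2') auto
          finally show ?case .
        qed
        show "(\<lambda>k. real k powr (-1/8)) \<longlonglongrightarrow> 0"
          by (rule tendsto_neg_powr[OF _ filterlim_real_sequentially]) simp
      qed
      then show ?thesis using integral_marchenko_pastur_three_term[OF assms(8), of r] Suc by simp
    qed
    note base = this[unfolded I_def]
    have "(\<lambda>k. integral\<^sup>L (\<mu> k \<omega>) (\<lambda>x. x ^ j)) \<longlonglongrightarrow> integral\<^sup>L (marchenko_pastur y) (\<lambda>x. x ^ j)" for j
    proof (rule moments_tendsto_of_three_term[OF _ mp_pow])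
      show "\<forall>\<^sub>F k in sequentially. \<forall>j. integrable (\<mu> k \<omega>) (\<lambda>x. x ^ j)"
        using nice by eventually_elim blast
    next
      show "(\<lambda>k. nb_beta (dL k) (dR k) r) \<longlonglongrightarrow> (if r = 0 then 1 else 1 + 1 / y)" for r
        by (rule nb_coefficients_tendsto(1)[OF assms(5,7,8)])
    next
      show "(\<lambda>k. nb_gamma (dL k) (dR k) (Suc r)) \<longlonglongrightarrow> 1 / y" for r
        by (rule nb_coefficients_tendsto(2)[OF assms(5,7,8)])
    qed (rule base)
    then show ?thesis
      by (intro moments_imp_weak_convergence[OF nice mp.prob_space_axioms sets_marchenko_pastur
            AE_marchenko_pastur_bounded[OF assms(8)] _ _ f]) auto
  qed
  \<comment> \<open>A countable intersection over the lengths gives one null set that serves for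
    every test function.\<close>
  have "AE \<omega> in M. \<forall>r. \<forall>\<^sub>F k in sequentially.
      real (card (closed_nb_walks (G k \<omega>) {..<m k + n k} (2 * Suc r))) < real (n k) powr (7/8)"
    unfolding AE_all_countable
    by (intro allI AE_few_closed_nb_walks[OF assms(1-5) small]) simp
  then have "AE \<omega> in M. \<forall>f :: real \<Rightarrow> real. continuous_on UNIV f \<and> bounded (range f) \<longrightarrow>
      (\<lambda>k. integral\<^sup>L (\<mu> k \<omega>) f) \<longlonglongrightarrow> integral\<^sup>L (marchenko_pastur y) f"
    using AE_space
  proof eventually_elim
    case (elim \<omega>)
    show ?case
    proof (intro allI impI)
      fix f :: "real \<Rightarrow> real" assume "continuous_on UNIV f \<and> bounded (range f)"
      then show "(\<lambda>k. integral\<^sup>L (\<mu> k \<omega>) f) \<longlonglongrightarrow> integral\<^sup>L (marchenko_pastur y) f"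
        using elim by (intro conv) auto
    qed
  qed
  then show ?thesis
    unfolding converges_almost_surely_def \<mu>_def[symmetric] by (auto elim: eventually_mono)
qed

end
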